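(* Let $(U,W)$ be an output normal pair with $W$ of size $n\times n$ and $U$ of size $p\times n$. (1) A lossless function $G(z)\in\mathcal{L}_n^p$, given by a balanced realization $(A,B,C,D)$, can be parametrized in the chart defined by the pair $(U,W)$ if and only if the solution $Q$ to the Stein equation $Q-A^*QW=C^*U$ is positive definite. (2) A balanced realization $\widetilde R=(A,B,C,D)$ of a lossless function $G\in\mathcal{L}_n^p$ is in canonical form with respect to this chart if and only if the solution $Q$ to $Q-A^*QW=C^*U$ is $P^{1/2}$, where $P$ is the solution, required to be positive definite, of $P-W^*PW=U^*U-V^*V$ with $V=\frac{1}{2i\pi}\int_{\mathbf{T}}G^\sharp(z)U(zI_n-W)^{-1}\,dz$.
   Context: $^*$ denotes conjugate transpose; $(\cdot)^{1/2}$ of a positive definite matrix is its Hermitian positive square root. $\mathbf{T}$ is the unit circle. $G^\sharp(z)=G(1/\bar z)^*$. A $p\times p$ rational matrix function $G$ is lossless if $G(z)G(z)^*\le I_p$ for $|z|>1$, with equality for $|z|=1$; $\mathcal{L}_n^p$ is the set of $p\times p$ lossless functions of McMillan degree $n$, and $\mathbb{U}(p)$ the set of constant $p\times p$ unitary matrices. A realization $(A,B,C,D)$ of $G$ means $G(z)=D+C(zI_n-A)^{-1}B$; for a lossless function, a balanced realization is a minimal realization for which the realization matrix $\begin{pmatrix}D&C\\ B&A\end{pmatrix}$ is unitary. An output normal pair $(U,W)$ is an observable pair with $W$ stable (eigenvalues in the open unit disk) and $U^*U+W^*W=I_n$. Chart defined by $(U,W)$: for $G\in\mathcal{L}_n^p$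 let $V=\frac{1}{2i\pi}\int_{\mathbf{T}}G^\sharp(z)U(zI_n-W)^{-1}dz$ and let $P$ solve $P-W^*PW=U^*U-V^*V$. $G$ can be parametrized in the chart (belongs to its domain) if $P$ is positive definite. In that case it is known that $G=T_{\hat\Theta_{W,U,V}}(G_0)$ for a unique $G_0\in\mathbb{U}(p)$, and the coordinates of $G$ are $(V,G_0)$ (with $G_0$ described by any local chart of $\mathbb{U}(p)$). Here, for $\Theta=(\Theta_{ij})_{i,j=1,2}$ with $p\times p$ blocks, $T_\Theta(F)=(\Theta_{11}F+\Theta_{12})(\Theta_{21}F+\Theta_{22})^{-1}$, and $\hat\Theta_{W,U,V}$ is as follows. Let $T=P^{1/2}$, $\tilde U=UT^{-1}$, $\tilde W=TWT^{-1}$, $\tilde V=VT^{-1}$, $X=I_p-U(I_n-W^* )^{-1}U^*$, $Y=(I_n-W)(I_n-W^* )^{-1}U^*$, $K=\tilde U^*\tilde U+\tilde W^*\tilde W=I_n+\tilde V^*\tilde V$, $L=\tilde U^*X+\tilde W^*TY$, $Z=X^*X+Y^*P^{-1}Y$, $$\mathcal{U}=\begin{pmatrix}X&\tilde U\\ TY&\tilde W\end{pmatrix}\begin{pmatrix}Z^{1/2}&0\\-K^{-1}LZ^{1/2}&K^{-1/2}\end{pmatrix},\qquad\mathcal{V}=\begin{pmatrix}(I_p+\tilde V\tilde V^* )^{-1/2}&\tilde V(I_n+\tilde V^*\tilde V)^{-1/2}\\-\tilde V^*(I_p+\tilde V\tilde V^* )^{-1/2}&(I_n+\tilde V^*\tilde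 V)^{-1/2}\end{pmatrix}$$ (unitary matrices). Writing $\mathcal{U}=\begin{pmatrix}M_u&\alpha_u\\\beta_u^*&K_u\end{pmatrix}$, $\mathcal{V}=\begin{pmatrix}M_v&\alpha_v\\\beta_v^*&K_v\end{pmatrix}$ with $M_u,M_v$ of size $p\times p$, and $J=\begin{pmatrix}I_p&0\\0&-I_p\end{pmatrix}$, $$\hat\Theta_{W,U,V}(z)=\begin{pmatrix}M_u&0\\0&M_v\end{pmatrix}+\begin{pmatrix}\alpha_u\\\alpha_v\end{pmatrix}(K_vz-K_u)^{-1}\begin{pmatrix}\beta_u^*&\beta_v^*\end{pmatrix}J\begin{pmatrix}I_p&0\\0&zI_p\end{pmatrix}.$$ Canonical form: a realization of a function $G$ in the domain of the chart is in canonical form with respect to the chart if its realization matrix is $\mathcal{U}\begin{pmatrix}G_0&0\\0&I_n\end{pmatrix}\mathcal{V}^*$, where $\mathcal{U}$, $\mathcal{V}$ are the unitary matrices above computed from $(W,U,V)$ with $T=P^{1/2}$, $V$ and $P$ being those attached to $G$, and $G_0\in\mathbb{U}(p)$ is the unique unitary matrix such that $G=T_{\hat\Theta_{W,U,V}}(G_0)$.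
   Formalization: In (1), positive definiteness of Q is required only after some unitary change of state coordinates of the given balanced realization; as worded it fails, e.g. U=1, W=0, G=1/z with (A,B,C,D)=(0,-1,-1,0) is in the chart, yet Q=-1. *)

theory Defs
  imports "HOL-Complex_Analysis.Complex_Analysis" "HOL-Computational_Algebra.Polynomial"
begin

unbundle no fps_syntax

section \<open>Complex matrices\<close>

definition cadj :: "complex^'n^'m \<Rightarrow> complex^'m^'n" where
  "cadj M = (\<chi> i j. cnj (M $ j $ i))"

definition unitary :: "complex^'n^'n \<Rightarrow> bool" where
  "unitary M \<longleftrightarrow> cadj M ** M = mat 1 \<and> M ** cadj M = mat 1"

definition hform :: "complex^'n^'n \<Rightarrow> complex^'n \<Rightarrow> complex" where
  "hform M x = (\<Sum>i\<in>UNIV. \<Sum>j\<in>UNIV. cnj (x $ i) * M $ i $ j * x $ j)"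

definition pos_semidef :: "complex^'n^'n \<Rightarrow> bool" where
  "pos_semidef M \<longleftrightarrow> cadj M = M \<and> (\<forall>x. 0 \<le> Re (hform M x))"

definition pos_def :: "complex^'n^'n \<Rightarrow> bool" where
  "pos_def M \<longleftrightarrow> cadj M = M \<and> (\<forall>x. x \<noteq> 0 \<longrightarrow> 0 < Re (hform M x))"

text \<open>Meaningful for positive definite arguments only.\<close>

definition hsqrt :: "complex^'n^'n \<Rightarrow> complex^'n^'n" where
  "hsqrt M = (THE S. pos_def S \<and> S ** S = M)"

definition stable :: "complex^'n^'n \<Rightarrow> bool" where
  "stable W \<longleftrightarrow> (\<forall>l v. v \<noteq> 0 \<and> W *v v = l *s v \<longrightarrow> cmod l < 1)"

definition observable :: "complex^'n^'p \<Rightarrow> complex^'n^'n \<Rightarrow> bool" where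
  "observable U W \<longleftrightarrow> (\<forall>x. (\<forall>k. U *v ((\<lambda>y. W *v y) ^^ k) x = 0) \<longrightarrow> x = 0)"

definition hcat :: "'a^('c::finite)^('r::finite) \<Rightarrow> 'a^('d::finite)^'r \<Rightarrow> 'a^('c + 'd)^'r" where
  "hcat M N = (\<chi> i j. case j of Inl c \<Rightarrow> M $ i $ c | Inr d \<Rightarrow> N $ i $ d)"

definition vcat :: "'a^('c::finite)^('r::finite) \<Rightarrow> 'a^'c^('s::finite) \<Rightarrow> 'a^'c^('r + 's)" where
  "vcat M N = (\<chi> i. case i of Inl r \<Rightarrow> M $ r | Inr s \<Rightarrow> N $ s)"

definition block_mat ::
  "'a^('c::finite)^('r::finite) \<Rightarrow> 'a^('d::finite)^'r \<Rightarrow> 'a^'c^('s::finite) \<Rightarrow> 'a^'d^'s \<Rightarrow> 'a^('c + 'd)^('r + 's)" where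
  "block_mat M11 M12 M21 M22 = vcat (hcat M11 M12) (hcat M21 M22)"

definition block11 :: "'a^(('c::finite) + ('d::finite))^(('r::finite) + ('s::finite)) \<Rightarrow> 'a^'c^'r" where
  "block11 M = (\<chi> i j. M $ Inl i $ Inl j)"

definition block12 :: "'a^(('c::finite) + ('d::finite))^(('r::finite) + ('s::finite)) \<Rightarrow> 'a^'d^'r" where
  "block12 M = (\<chi> i j. M $ Inl i $ Inr j)"

definition block21 :: "'a^(('c::finite) + ('d::finite))^(('r::finite) + ('s::finite)) \<Rightarrow> 'a^'c^'s" where
  "block21 M = (\<chi> i j. M $ Inr i $ Inl j)"

definition block22 :: "'a^(('c::finite) + ('d::finite))^(('r::finite) + ('s::finite)) \<Rightarrow> 'a^'d^'s" where
  "block22 M = (\<chi> i j. M $ Inr i $ Inr j)"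

text \<open>\<open>stein_sol A W R\<close> is the solution \<open>Q\<close> of \<open>Q - A\<^sup>* Q W = R\<close>; it is unique when
  \<open>A\<close> and \<open>W\<close> are stable.\<close>

definition stein_sol ::
  "complex^'n^'n \<Rightarrow> complex^'n^'n \<Rightarrow> complex^'n^'n \<Rightarrow> complex^'n^'n" where
  "stein_sol A W R = (THE Q. Q - cadj A ** Q ** W = R)"


section \<open>Rational matrix functions, realizations, lossless functions\<close>

text \<open>A rational matrix function is represented by its values. The fractions are reduced, so
  the values at all points that are not poles are determined; values at poles are
  irrelevant.\<close>

definition rational_matrix :: "(complex \<Rightarrow> complex^'n^'m) \<Rightarrow> bool" where
  "rational_matrix G \<longleftrightarrow> (\<forall>i j. \<exists>f g :: complex poly. g \<noteq> 0 \<and> coprime f g \<and>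
     (\<forall>z. poly g z \<noteq> 0 \<longrightarrow> G z $ i $ j = poly f z / poly g z))"

text \<open>Equality as rational functions, regardless of the values at poles (where
  \<^const>\<open>matrix_inv\<close> is unspecified).\<close>

definition eq_rational :: "(complex \<Rightarrow> 'a) \<Rightarrow> (complex \<Rightarrow> 'a) \<Rightarrow> bool" where
  "eq_rational F G \<longleftrightarrow> finite {z. F z \<noteq> G z}"

definition realization ::
  "(complex \<Rightarrow> complex^'m^'p) \<Rightarrow> complex^'n^'n \<Rightarrow> complex^'m^'n \<Rightarrow> complex^'n^'p \<Rightarrow> complex^'m^'p \<Rightarrow> bool" where
  "realization G A B C D \<longleftrightarrow>
     eq_rational G (\<lambda>z. D + C ** matrix_inv (mat z - A) ** B)"

definition realization_matrix ::
  "complex^('n::finite)^'n \<Rightarrow> complex^('m::finite)^'n \<Rightarrow> complex^'n^('p::finite) \<Rightarrow> complex^'m^'p \<Rightarrow> complex^('m + 'n)^('p + 'n)" where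
  "realization_matrix A B C D = block_mat D C B A"

text \<open>The McMillan degree is the least state dimension of a realization. Comparing different
  dimensions requires the state dimension to be a number, not a type; therefore the state
  matrices are functions on \<open>{..<k}\<close> here, and \<open>X = (z I - A)\<^sup>-\<^sup>1 B\<close> is
  expressed by the linear system that determines it when \<open>z\<close> is not one of the finitely many
  eigenvalues of \<open>A\<close>.\<close>

definition has_realization_of_dim :: "(complex \<Rightarrow> complex^'m^'p) \<Rightarrow> nat \<Rightarrow> bool" where
  "has_realization_of_dim G k \<longleftrightarrow>
     (\<exists>(A :: nat \<Rightarrow> nat \<Rightarrow> complex) (B :: nat \<Rightarrow> 'm \<Rightarrow> complex)
        (C :: 'p \<Rightarrow> nat \<Rightarrow> complex) (D :: 'p \<Rightarrow> 'm \<Rightarrow> complex).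
        finite {z. \<not> (\<exists>X :: nat \<Rightarrow> 'm \<Rightarrow> complex.
          (\<forall>i<k. \<forall>b. z * X i b - (\<Sum>j<k. A i j * X j b) = B i b) \<and>
          (\<forall>a b. G z $ a $ b = D a b + (\<Sum>i<k. C a i * X i b)))})"

definition has_mcmillan_degree :: "(complex \<Rightarrow> complex^'m^'p) \<Rightarrow> nat \<Rightarrow> bool" where
  "has_mcmillan_degree G n \<longleftrightarrow>
     has_realization_of_dim G n \<and> (\<forall>k<n. \<not> has_realization_of_dim G k)"

definition lossless :: "(complex \<Rightarrow> complex^'p^'p) \<Rightarrow> bool" where
  "lossless G \<longleftrightarrow> rational_matrix G \<and>
     (\<forall>z. cmod z > 1 \<longrightarrow> pos_semidef (mat 1 - G z ** cadj (G z))) \<and>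
     (\<forall>z. cmod z = 1 \<longrightarrow> G z ** cadj (G z) = mat 1)"

definition lossless_of_degree :: "nat \<Rightarrow> (complex \<Rightarrow> complex^'p^'p) set" where
  "lossless_of_degree n = {G. lossless G \<and> has_mcmillan_degree G n}"

definition minimal_realization ::
  "(complex \<Rightarrow> complex^'m^'p) \<Rightarrow> complex^'n^'n \<Rightarrow> complex^'m^'n \<Rightarrow> complex^'n^'p \<Rightarrow> complex^'m^'p \<Rightarrow> bool" where
  "minimal_realization G A (B :: complex^'m^'n) C D \<longleftrightarrow>
     realization G A B C D \<and> has_mcmillan_degree G CARD('n)"

definition balanced_realization ::
  "(complex \<Rightarrow> complex^'p^'p) \<Rightarrow> complex^'n^'n \<Rightarrow> complex^'p^'n \<Rightarrow> complex^'n^'p \<Rightarrow> complex^'p^'p \<Rightarrow> bool" where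
  "balanced_realization G A B C D \<longleftrightarrow>
     minimal_realization G A B C D \<and> unitary (realization_matrix A B C D)"

text \<open>A balanced realization is determined only up to a unitary change of state coordinates:
  for unitary \<open>S\<close>, \<open>(A, B, C, D)\<close> and
  \<open>(S A S\<^sup>*, S B, C S\<^sup>*, D)\<close> are balanced realizations of the same function.
  The change replaces the solution \<open>Q\<close> of \<open>Q - A\<^sup>* Q W = C\<^sup>* U\<close> by
  \<open>S Q\<close>; for instance \<open>S = -I\<close> turns \<open>Q\<close> into \<open>-Q\<close>. So positive
  definiteness of \<open>Q\<close> depends on the coordinates, and a criterion on the function itself
  has to ask for it in suitable coordinates.\<close>


section \<open>The chart attached to an output normal pair\<close>

definition output_normal_pair :: "complex^'n^'p \<Rightarrow> complex^'n^'n \<Rightarrow> bool" where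
  "output_normal_pair U W \<longleftrightarrow>
     observable U W \<and> stable W \<and> cadj U ** U + cadj W ** W = mat 1"

definition sharp :: "(complex \<Rightarrow> complex^'m^'p) \<Rightarrow> complex \<Rightarrow> complex^'p^'m" where
  "sharp G z = cadj (G (1 / cnj z))"

definition chart_V :: "complex^'n^'p \<Rightarrow> complex^'n^'n \<Rightarrow> (complex \<Rightarrow> complex^'p^'p) \<Rightarrow> complex^'n^'p" where
  "chart_V U W G = (\<chi> i j. 1 / (2 * \<i> * of_real pi) *
     contour_integral (circlepath 0 1)
       (\<lambda>z. (sharp G z ** U ** matrix_inv (mat z - W)) $ i $ j))"

definition chart_P :: "complex^'n^'p \<Rightarrow> complex^'n^'n \<Rightarrow> complex^'n^'p \<Rightarrow> complex^'n^'n" where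
  "chart_P U W V = stein_sol W W (cadj U ** U - cadj V ** V)"

definition in_chart :: "complex^'n^'p \<Rightarrow> complex^'n^'n \<Rightarrow> (complex \<Rightarrow> complex^'p^'p) \<Rightarrow> bool" where
  "in_chart U W G \<longleftrightarrow> pos_def (chart_P U W (chart_V U W G))"

definition chart_calU ::
  "complex^('n::finite)^('p::finite) \<Rightarrow> complex^'n^'n \<Rightarrow> complex^'n^'p \<Rightarrow> complex^('p + 'n)^('p + 'n)" where
  "chart_calU U W V =
    (let P = chart_P U W V;
         T = hsqrt P;
         Ut = U ** matrix_inv T;
         Wt = T ** W ** matrix_inv T;
         X = mat 1 - U ** matrix_inv (mat 1 - cadj W) ** cadj U;
         Y = (mat 1 - W) ** matrix_inv (mat 1 - cadj W) ** cadj U;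
         K = cadj Ut ** Ut + cadj Wt ** Wt;
         L = cadj Ut ** X + cadj Wt ** T ** Y;
         Z = cadj X ** X + cadj Y ** matrix_inv P ** Y
     in block_mat X Ut (T ** Y) Wt **
        block_mat (hsqrt Z) 0
                  (- (matrix_inv K ** L ** hsqrt Z)) (matrix_inv (hsqrt K)))"

definition chart_calV ::
  "complex^('n::finite)^('p::finite) \<Rightarrow> complex^'n^'n \<Rightarrow> complex^'n^'p \<Rightarrow> complex^('p + 'n)^('p + 'n)" where
  "chart_calV U W V =
    (let Vt = V ** matrix_inv (hsqrt (chart_P U W V));
         E = matrix_inv (hsqrt (mat 1 + Vt ** cadj Vt));
         F = matrix_inv (hsqrt (mat 1 + cadj Vt ** Vt))
     in block_mat E (Vt ** F) (- (cadj Vt ** E)) F)"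

definition chart_Theta ::
  "complex^('n::finite)^'n \<Rightarrow> complex^'n^('p::finite) \<Rightarrow> complex^'n^'p \<Rightarrow> complex \<Rightarrow> complex^('p + 'p)^('p + 'p)" where
  "chart_Theta W U V z =
    (let Cu = chart_calU U W V;
         Cv = chart_calV U W V
     in block_mat (block11 Cu) 0 0 (block11 Cv) +
        vcat (block12 Cu) (block12 Cv) **
        matrix_inv (block22 Cv ** mat z - block22 Cu) **
        hcat (block21 Cu) (block21 Cv) **
        block_mat (mat 1) 0 0 (- mat 1) **
        block_mat (mat 1) 0 0 (mat z))"

definition lft :: "complex^(('p::finite) + 'p)^('p + 'p) \<Rightarrow> complex^'p^'p \<Rightarrow> complex^'p^'p" where
  "lft M F = (block11 M ** F + block12 M) ** matrix_inv (block21 M ** F + block22 M)"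

definition chart_G0 :: "complex^'n^'p \<Rightarrow> complex^'n^'n \<Rightarrow> (complex \<Rightarrow> complex^'p^'p) \<Rightarrow> complex^'p^'p" where
  "chart_G0 U W G = (THE F. unitary F \<and>
     eq_rational G (\<lambda>z. lft (chart_Theta W U (chart_V U W G) z) F))"

definition canonical_realization ::
  "complex^'n^'p \<Rightarrow> complex^'n^'n \<Rightarrow> (complex \<Rightarrow> complex^'p^'p) \<Rightarrow>
   complex^'n^'n \<Rightarrow> complex^'p^'n \<Rightarrow> complex^'n^'p \<Rightarrow> complex^'p^'p \<Rightarrow> bool" where
  "canonical_realization U W G A B C D \<longleftrightarrow>
     in_chart U W G \<and> realization G A B C D \<and>
     realization_matrix A B C D =
       chart_calU U W (chart_V U W G) **
       block_mat (chart_G0 U W G) 0 0 (mat 1) **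
       cadj (chart_calV U W (chart_V U W G))"

end

theory Submission
  imports Defs
begin

text \<open>
  Let \<open>R\<close> be the unitary realization matrix of \<open>G\<close>, with block rows \<open>(D, C)\<close> and \<open>(B, A)\<close>, and let \<open>Q\<close>
  be the solution of \<open>Q - A\<^sup>* Q W = C\<^sup>* U\<close>. Everything rests on one identity, \<open>R\<^sup>* [U; Q W] = [V; Q]\<close>
  (lemma \<open>balanced_stein\<close>). Its second row is the Stein equation. Its first row is
  \<open>V = D\<^sup>* U + B\<^sup>* Q W\<close>, the value of the contour integral that defines \<open>V\<close>
  (\<open>chart_V_eq\<close>): the Stein equation splits \<open>(I - z A\<^sup>*)\<^sup>-\<^sup>1 C\<^sup>* U (z I - W)\<^sup>-\<^sup>1\<close> into a part that is
  holomorphic inside the unit circle and a multiple of \<open>(z I - W)\<^sup>-\<^sup>1\<close>. The same splitting shows that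
  Stein equations with stable coefficients are uniquely solvable (\<open>stein_ex1\<close>). The matrix \<open>A\<close> is
  stable because an eigenvector for an eigenvalue on the circle would be unobservable and could be
  divided out, against the minimality of the realization (\<open>balanced_realization_stable\<close>).

  Comparing Gram matrices in the identity gives \<open>P = Q\<^sup>* Q\<close> (\<open>chart_P_eq\<close>). Hence \<open>G\<close> is in
  the domain of the chart if and only if \<open>Q\<close> is invertible. A unitary change \<open>S\<close> of the state
  coordinates replaces \<open>Q\<close> by \<open>S Q\<close>, and \<open>S = P\<^sup>1\<^sup>/\<^sup>2 Q\<^sup>-\<^sup>1\<close> makes it positive definite. This is the first
  part.

  For the second part let \<open>T = P\<^sup>1\<^sup>/\<^sup>2\<close>. The second block columns of the unitary matrices \<open>\<U>\<close> and \<open>\<V>\<close> are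
  \<open>[U; T W] N\<close> and \<open>[V; T] N\<close> with the same invertible \<open>N\<close>, so \<open>\<U>\<^sup>* R \<V>\<close> fixes the second block of
  coordinates if and only if \<open>R\<^sup>* [U; T W] = [V; T]\<close> (\<open>calU_calV_transfer\<close>). By the identity
  and the uniqueness of \<open>Q\<close> this means \<open>Q = T\<close>. A unitary matrix that fixes these coordinates is
  \<open>diag(F, I)\<close> with \<open>F\<close> unitary. That this \<open>F\<close> is the matrix \<open>G\<^sub>0\<close> of the linear fractional
  parametrization is seen by solving the state equations in the coordinates given by \<open>\<U>\<close> and \<open>\<V>\<close>
  (\<open>lft_chart_Theta\<close>); the parametrization is injective because \<open>K\<^sub>v\<^sup>* - z K\<^sub>u\<^sup>*\<close>, formed from the
  lower right blocks of \<open>\<V>\<close> and \<open>\<U>\<close>, is invertible on the circle (\<open>lft_chart_Theta_inj\<close>).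
\<close>

section \<open>Complex matrices\<close>

lemma cadj_cadj [simp]: "cadj (cadj M) = M"
  by (simp add: cadj_def vec_eq_iff)

lemma cadj_mult: "cadj (M ** N) = cadj N ** cadj M"
  by (simp add: cadj_def matrix_matrix_mult_def vec_eq_iff mult.commute)

lemma cadj_add: "cadj (M + N) = cadj M + cadj N"
  by (simp add: cadj_def vec_eq_iff)

lemma cadj_diff: "cadj (M - N) = cadj M - cadj N"
  by (simp add: cadj_def vec_eq_iff)

lemma cadj_uminus: "cadj (- M) = - cadj M"
  by (simp add: cadj_def vec_eq_iff)

lemma cadj_zero [simp]: "cadj 0 = 0"
  by (simp add: cadj_def vec_eq_iff)

lemma cadj_mat: "cadj (mat z) = mat (cnj z)"
  by (simp add: cadj_def mat_def vec_eq_iff)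

lemma cadj_one [simp]: "cadj (mat 1) = mat 1"
  by (simp add: cadj_mat)

lemma cadj_scaleR: "cadj (r *\<^sub>R M) = r *\<^sub>R cadj M"
  by (simp add: cadj_def vec_eq_iff)

lemma scaleR_mult_vector: "(r *\<^sub>R (M :: complex^'n^'m)) *v x = r *\<^sub>R (M *v x)"
  by (simp add: matrix_vector_mult_def vec_eq_iff scaleR_sum_right)

lemma mult_scaleR_vector: "(M :: complex^'n^'m) *v (r *\<^sub>R x) = r *\<^sub>R (M *v x)"
  by (simp add: matrix_vector_mult_def vec_eq_iff scaleR_sum_right)

lemmas cadj_simps = cadj_mult cadj_add cadj_diff cadj_uminus cadj_mat

lemma matrix_add_rdistrib: "(B + C) ** (A :: complex^'n^'m) = B ** A + C ** A"
  by (simp add: matrix_matrix_mult_def vec_eq_iff algebra_simps sum.distrib)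

lemma matrix_diff_ldistrib: "(A :: complex^'n^'m) ** (B - C) = A ** B - A ** C"
  by (simp add: matrix_matrix_mult_def vec_eq_iff algebra_simps sum_subtractf)

lemma matrix_diff_rdistrib: "(B - C) ** (A :: complex^'n^'m) = B ** A - C ** A"
  by (simp add: matrix_matrix_mult_def vec_eq_iff algebra_simps sum_subtractf)

lemma matrix_uminus_left: "(- B) ** (A :: complex^'n^'m) = - (B ** A)"
  by (simp add: matrix_matrix_mult_def vec_eq_iff sum_negf)

lemma matrix_uminus_right: "(A :: complex^'n^'m) ** (- B) = - (A ** B)"
  by (simp add: matrix_matrix_mult_def vec_eq_iff sum_negf)

lemma matrix_zero_left [simp]: "0 ** (A :: complex^'n^'m) = 0"
  by (simp add: matrix_matrix_mult_def vec_eq_iff)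

lemma matrix_zero_right [simp]: "(A :: complex^'n^'m) ** 0 = 0"
  by (simp add: matrix_matrix_mult_def vec_eq_iff)

lemmas matrix_distribs = matrix_add_ldistrib matrix_add_rdistrib
  matrix_diff_ldistrib matrix_diff_rdistrib matrix_uminus_left matrix_uminus_right

lemma mat_mult_component: "(mat z ** (M :: complex^'n^'m)) $ i $ j = z * M $ i $ j"
  by (simp add: matrix_matrix_mult_def mat_def if_distrib [of "\<lambda>x. x * _"] cong: if_cong)

lemma mult_mat_component: "((M :: complex^'n^'m) ** mat z) $ i $ j = z * M $ i $ j"
  by (simp add: matrix_matrix_mult_def mat_def if_distrib [of "\<lambda>x. _ * x"] mult.commute cong: if_cong)

lemma mat_commute: "(M :: complex^'n^'m) ** mat z = mat z ** M"
  by (simp add: vec_eq_iff mat_mult_component mult_mat_component)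

lemma mat_mult_mat: "mat a ** mat b = (mat (a * b) :: complex^'n^'n)"
  by (simp add: vec_eq_iff mat_mult_component) (simp add: mat_def)

lemma mat_vector_mult: "(mat z :: complex^'n^'n) *v x = z *s x"
  by (simp add: vec_eq_iff matrix_vector_mult_def mat_def if_distrib [of "\<lambda>x. x * _"] cong: if_cong)

lemma matrix_inv_right: "invertible M \<Longrightarrow> (M :: complex^'n^'n) ** matrix_inv M = mat 1"
  and matrix_inv_left: "invertible M \<Longrightarrow> matrix_inv M ** (M :: complex^'n^'n) = mat 1"
  unfolding invertible_def matrix_inv_def by (metis (mono_tags, lifting) someI_ex)+

lemma matrix_inv_right_assoc:
  "invertible M \<Longrightarrow> (N ** (M :: complex^'n^'n)) ** matrix_inv M = N"
  and matrix_inv_left_assoc: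
  "invertible M \<Longrightarrow> (N ** matrix_inv M) ** (M :: complex^'n^'n) = N"
  by (simp_all add: matrix_mul_assoc [symmetric] matrix_inv_right matrix_inv_left)

lemma matrix_inv_eqI: "(M :: complex^'n^'n) ** N = mat 1 \<Longrightarrow> matrix_inv M = N"
  by (metis invertible_right_inverse matrix_inv_left matrix_mul_assoc matrix_mul_lid matrix_mul_rid)

lemma invertibleI: "(M :: complex^'n^'n) ** N = mat 1 \<Longrightarrow> invertible M"
  by (auto simp: invertible_right_inverse)

lemma invertible_matrix_inv: "invertible (M :: complex^'n^'n) \<Longrightarrow> invertible (matrix_inv M)"
  using invertibleI matrix_inv_left by blast

lemma invertible_cadj_iff: "invertible (cadj M) \<longleftrightarrow> invertible (M :: complex^'n^'n)"
proof -
  have "invertible (cadj M)" if "invertible M" for M :: "complex^'n^'n"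
    by (rule invertibleI [where N = "cadj (matrix_inv M)"])
      (simp add: cadj_mult [symmetric] matrix_inv_left that)
  from this [of M] this [of "cadj M"] show ?thesis by auto
qed

lemma cadj_matrix_inv:
  assumes "invertible (M :: complex^'n^'n)"
  shows "cadj (matrix_inv M) = matrix_inv (cadj M)"
  by (rule matrix_inv_eqI [symmetric])
    (simp add: cadj_mult [symmetric] matrix_inv_left assms)

lemma invertible_iff_ker: "invertible (M :: complex^'n^'n) \<longleftrightarrow> (\<forall>x. M *v x = 0 \<longrightarrow> x = 0)"
  by (simp add: invertible_left_inverse matrix_left_invertible_ker)

lemma unitaryI: "cadj M ** M = mat 1 \<Longrightarrow> unitary M"
  by (simp add: unitary_def matrix_left_right_inverse)

lemma unitary_one: "unitary (mat 1)"
  by (simp add: unitary_def)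

lemma unitary_cadj: "unitary M \<Longrightarrow> unitary (cadj M)"
  by (simp add: unitary_def)

lemma unitary_mult:
  assumes "unitary M" "unitary N"
  shows "unitary (M ** N)"
proof (rule unitaryI)
  have "cadj (M ** N) ** (M ** N) = cadj N ** (cadj M ** M) ** N"
    by (simp add: cadj_mult matrix_mul_assoc)
  then show "cadj (M ** N) ** (M ** N) = mat 1"
    using assms by (simp add: unitary_def)
qed


section \<open>Positive definite matrices and their square roots\<close>

text \<open>The real part of the Hermitian product on \<open>\<complex>\<^sup>n\<close> is the Euclidean inner product of the
  library, so that positivity can be treated with the latter.\<close>

lemma inner_eq_Re: "x \<bullet> (y :: complex^'n) = Re (\<Sum>i\<in>UNIV. cnj (x $ i) * y $ i)"
  by (simp add: inner_vec_def inner_complex_def)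

lemma Re_hform: "Re (hform M x) = x \<bullet> (M *v x)"
  by (simp only: hform_def inner_eq_Re matrix_vector_mult_def vec_lambda_beta sum_distrib_left
      mult.assoc)

lemma inner_cadj: "x \<bullet> (M *v y) = (cadj M *v x) \<bullet> y"
proof -
  have "(\<Sum>i\<in>UNIV. cnj (x $ i) * (M *v y) $ i)
      = (\<Sum>i\<in>UNIV. \<Sum>j\<in>UNIV. cnj (x $ i) * M $ i $ j * y $ j)"
    by (simp add: matrix_vector_mult_def sum_distrib_left mult.assoc)
  also have "\<dots> = (\<Sum>j\<in>UNIV. \<Sum>i\<in>UNIV. cnj (x $ i) * M $ i $ j * y $ j)"
    by (rule sum.swap)
  also have "\<dots> = (\<Sum>j\<in>UNIV. cnj ((cadj M *v x) $ j) * y $ j)"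
    by (simp add: matrix_vector_mult_def cadj_def sum_distrib_left mult_ac)
  finally show ?thesis
    by (simp only: inner_eq_Re)
qed

lemma inner_gram: "x \<bullet> ((cadj M ** M) *v x) = (norm (M *v x))\<^sup>2"
  by (simp add: inner_cadj power2_norm_eq_inner flip: matrix_vector_mul_assoc)

lemma pos_def_iff:
  "pos_def M \<longleftrightarrow> cadj M = M \<and> (\<forall>x. x \<noteq> 0 \<longrightarrow> 0 < x \<bullet> (M *v x))"
  by (simp add: pos_def_def Re_hform)

lemma pos_def_invertible: "pos_def M \<Longrightarrow> invertible M"
  unfolding pos_def_iff invertible_iff_ker
  by (metis inner_zero_right less_irrefl)

lemma pos_def_cadj: "pos_def M \<Longrightarrow> cadj M = M"
  by (simp add: pos_def_def)

lemma pos_def_gram_sum: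
  assumes "\<And>x. M *v x = 0 \<Longrightarrow> N *v x = 0 \<Longrightarrow> x = 0"
  shows "pos_def (cadj M ** M + cadj N ** N)"
  unfolding pos_def_iff
proof (intro conjI allI impI)
  show "cadj (cadj M ** M + cadj N ** N) = cadj M ** M + cadj N ** N"
    by (simp add: cadj_simps)
  fix x :: "complex^'a" assume "x \<noteq> 0"
  then have "M *v x \<noteq> 0 \<or> N *v x \<noteq> 0"
    using assms by blast
  then have "0 < (norm (M *v x))\<^sup>2 + (norm (N *v x))\<^sup>2"
    by (metis add_nonneg_pos add_pos_nonneg zero_le_power2 zero_less_norm_iff zero_less_power)
  then show "0 < x \<bullet> ((cadj M ** M + cadj N ** N) *v x)"
    by (simp add: matrix_vector_mult_add_rdistrib inner_add_right inner_gram)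
qed

lemma pos_def_gram_iff: "pos_def (cadj M ** M) \<longleftrightarrow> invertible (M :: complex^'n^'n)"
proof
  assume "pos_def (cadj M ** M)"
  then show "invertible M"
    by (metis invertible_iff_ker matrix_vector_mul_assoc matrix_vector_mult_0_right pos_def_invertible)
next
  assume "invertible M"
  then show "pos_def (cadj M ** M)"
    using pos_def_gram_sum [of M "0 :: complex^'n^'n"] by (simp add: invertible_iff_ker)
qed

lemma norm_matrix_columns:
  "(norm (M :: complex^'n^'m))\<^sup>2 = (\<Sum>j\<in>UNIV. (norm (column j M))\<^sup>2)"
  unfolding norm_vec_def L2_set_def column_def
  by (simp add: sum_nonneg) (rule sum.swap)

lemma norm_cadj: "norm (cadj M) = norm M"
proof -
  have "(norm (cadj M))\<^sup>2 = (norm M)\<^sup>2"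
    by (rule trans [OF norm_matrix_columns])
      (simp add: norm_vec_def L2_set_def column_def cadj_def sum_nonneg)
  then show ?thesis
    by simp
qed

text \<open>The Hilbert-Schmidt norm, which is the library's norm of a matrix, is multiplied at
  most by the operator norm of a factor. This gives a contraction below although the
  Hilbert-Schmidt norm of the factors may exceed one.\<close>

lemma norm_mult_left_le:
  fixes M :: "complex^'n^'m" and N :: "complex^'k^'n"
  assumes "0 \<le> r" and M: "\<And>x. norm (M *v x) \<le> r * norm x"
  shows "norm (M ** N) \<le> r * norm N"
proof (rule power2_le_imp_le)
  have col: "column j (M ** N) = M *v column j N" for j
    by (simp add: column_def matrix_matrix_mult_def matrix_vector_mult_def)
  have "(norm (M ** N))\<^sup>2 = (\<Sum>j\<in>UNIV. (norm (M *v column j N))\<^sup>2)"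
    by (simp add: norm_matrix_columns col)
  also have "\<dots> \<le> (\<Sum>j\<in>UNIV. (r * norm (column j N))\<^sup>2)"
    by (intro sum_mono power_mono M) simp
  also have "\<dots> = (r * norm N)\<^sup>2"
    by (simp add: norm_matrix_columns power_mult_distrib sum_distrib_left)
  finally show "(norm (M ** N))\<^sup>2 \<le> (r * norm N)\<^sup>2" .
qed (use \<open>0 \<le> r\<close> in simp)

text \<open>A Hermitian strict contraction \<open>E\<close> has \<open>(I - Y)\<^sup>2 = I - E\<close> for the fixed point \<open>Y\<close> of the
  map \<open>Y \<mapsto> (E + Y\<^sup>2) / 2\<close>, which is a contraction on the Hermitian matrices bounded by \<open>r\<close>.\<close>

lemma sqrt_one_minus:
  fixes E :: "complex^'n^'n"
  assumes herm: "cadj E = E" and r: "0 \<le> r" "r < 1"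
    and E: "\<And>x. norm (E *v x) \<le> r * norm x"
  shows "\<exists>S. pos_def S \<and> S ** S = mat 1 - E"
proof -
  define s where "s = {Y :: complex^'n^'n. cadj Y = Y \<and> (\<forall>x. norm (Y *v x) \<le> r * norm x)}"
  define f where "f Y = (1/2) *\<^sub>R (E + Y ** Y)" for Y :: "complex^'n^'n"
  have "closed s"
    unfolding s_def
    by (intro closed_Collect_conj closed_Collect_eq closed_Collect_all closed_Collect_le)
      (auto simp: cadj_def matrix_vector_mult_def intro!: continuous_intros)
  have "0 \<in> s"
    using r by (simp add: s_def)
  have f_s: "f Y \<in> s" if "Y \<in> s" for Y
  proof -
    have Y: "cadj Y = Y" "norm (Y *v x) \<le> r * norm x" for x
      using that by (auto simp: s_def)
    have "norm (f Y *v x) \<le> r * norm x" for x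
    proof -
      have "norm (Y *v (Y *v x)) \<le> r * (r * norm x)"
        using Y(2) [of "Y *v x"] mult_left_mono [OF Y(2) [of x] r(1)] by linarith
      also have "\<dots> \<le> 1 * (r * norm x)"
        using r by (intro mult_right_mono) auto
      finally have "norm (E *v x + Y *v (Y *v x)) \<le> 2 * (r * norm x)"
        using E [of x] norm_triangle_ineq [of "E *v x" "Y *v (Y *v x)"] by linarith
      then show ?thesis
        unfolding f_def scaleR_mult_vector
          matrix_vector_mult_add_rdistrib matrix_vector_mul_assoc [symmetric] by simp
    qed
    then show ?thesis
      by (simp add: s_def f_def cadj_scaleR cadj_simps Y(1) herm)
  qed
  have contr: "dist (f Y) (f Z) \<le> r * dist Y Z" if "Y \<in> s" "Z \<in> s" for Y Z
  proof -
    have Y: "norm (Y *v x) \<le> r * norm x" and Z: "cadj Z = Z" "norm (Z *v x) \<le> r * norm x" for x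
      using that by (auto simp: s_def)
    have "norm (Y ** (Y - Z)) \<le> r * norm (Y - Z)"
      by (rule norm_mult_left_le [OF r(1) Y])
    moreover have "norm ((Y - Z) ** Z) \<le> r * norm (Y - Z)"
    proof -
      have "norm ((Y - Z) ** Z) = norm (Z ** cadj (Y - Z))"
        by (metis Z(1) cadj_mult norm_cadj)
      also have "\<dots> \<le> r * norm (cadj (Y - Z))"
        by (rule norm_mult_left_le [OF r(1) Z(2)])
      finally show ?thesis by (simp add: norm_cadj)
    qed
    ultimately have "norm (Y ** (Y - Z) + (Y - Z) ** Z) \<le> 2 * (r * norm (Y - Z))"
      using norm_triangle_ineq [of "Y ** (Y - Z)" "(Y - Z) ** Z"] by linarith
    moreover have "f Y - f Z = (1/2) *\<^sub>R (Y ** (Y - Z) + (Y - Z) ** Z)"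
      by (simp add: f_def matrix_distribs flip: scaleR_diff_right)
    ultimately show ?thesis
      by (simp add: dist_norm)
  qed
  obtain Y where "Y \<in> s" "f Y = Y"
    using Banach_fix [of s r f] \<open>closed s\<close> \<open>0 \<in> s\<close> r f_s contr
    by (auto simp: complete_eq_closed)
  then have Y: "cadj Y = Y" "norm (Y *v x) \<le> r * norm x" for x
    by (auto simp: s_def)
  have "E + Y ** Y = 2 *\<^sub>R Y"
    using \<open>f Y = Y\<close> by (simp add: f_def) (metis scaleR_half_double scaleR_2 scaleR_right_distrib)
  then have sq: "(mat 1 - Y) ** (mat 1 - Y) = mat 1 - E"
    by (simp add: matrix_distribs scaleR_2 algebra_simps)
  have "0 < x \<bullet> ((mat 1 - Y) *v x)" if "x \<noteq> 0" for x
  proof -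
    have "x \<bullet> (Y *v x) \<le> norm x * (r * norm x)"
      using norm_cauchy_schwarz [of x "Y *v x"] mult_left_mono [OF Y(2) [of x] norm_ge_zero [of x]]
      by linarith
    also have "\<dots> < norm x * norm x"
      using r that by simp
    finally show ?thesis
      by (simp add: matrix_vector_mult_diff_rdistrib inner_diff_right dot_square_norm power2_eq_square)
  qed
  then have "pos_def (mat 1 - Y)"
    by (simp add: pos_def_iff cadj_simps Y(1))
  with sq show ?thesis by blast
qed

text \<open>A small positive multiple \<open>c P\<close> of a positive definite matrix has the form \<open>I - E\<close> with a
  strict contraction \<open>E\<close>.\<close>

lemma pos_def_sqrt_exists:
  fixes P :: "complex^'n^'n"
  assumes "pos_def P"
  shows "\<exists>S. pos_def S \<and> S ** S = P"
proof -
  have P: "cadj P = P" "x \<noteq> 0 \<Longrightarrow> 0 < x \<bullet> (P *v x)" for x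
    using assms by (auto simp: pos_def_iff)
  obtain b where b: "b > 0" "\<And>x. norm (P *v x) \<le> b * norm x"
    using bounded_linear.pos_bounded [OF matrix_vector_mul_bounded_linear [of P]]
    by (auto simp: mult.commute)
  have "\<exists>x\<in>sphere 0 1. \<forall>y\<in>sphere 0 1. x \<bullet> (P *v x) \<le> y \<bullet> (P *v y)"
  proof (rule continuous_attains_inf)
    have "axis undefined 1 \<in> sphere (0 :: complex^'n) 1"
      by simp
    then show "sphere (0 :: complex^'n) 1 \<noteq> {}"
      by blast
    show "continuous_on (sphere 0 1) (\<lambda>x. x \<bullet> (P *v x))"
      by (intro continuous_intros linear_continuous_on) auto
  qed auto
  then obtain x0 where x0: "norm x0 = 1" "\<And>y. norm y = 1 \<Longrightarrow> x0 \<bullet> (P *v x0) \<le> y \<bullet> (P *v y)"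
    by auto
  define d where "d = x0 \<bullet> (P *v x0)"
  have "d > 0"
    using P(2) [of x0] x0(1) unfolding d_def by fastforce
  have lower: "d * (norm x)\<^sup>2 \<le> x \<bullet> (P *v x)" for x
  proof (cases "x = 0")
    case False
    have "d \<le> (x /\<^sub>R norm x) \<bullet> (P *v (x /\<^sub>R norm x))"
      unfolding d_def using False by (intro x0(2)) simp
    then show ?thesis
      using False by (simp add: mult_scaleR_vector field_simps power2_eq_square)
  qed simp
  have "d \<le> b"
  proof -
    have "d \<le> norm x0 * norm (P *v x0)"
      unfolding d_def by (rule norm_cauchy_schwarz)
    also have "\<dots> \<le> b"
      using b(2) [of x0] by (simp add: x0(1))
    finally show ?thesis .
  qed
  \<comment> \<open>\<open>\<parallel>(I - c P) x\<parallel>\<^sup>2 \<le> (1 - 2 c d + c\<^sup>2 b\<^sup>2) \<parallel>x\<parallel>\<^sup>2\<close>, and \<open>c = d / b\<^sup>2\<close> minimizes the bound.\<close>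
  define c where "c = d / b\<^sup>2"
  define r where "r = sqrt (1 - (d / b)\<^sup>2)"
  have "c > 0"
    using \<open>d > 0\<close> b(1) by (simp add: c_def)
  have "(d / b)\<^sup>2 \<le> 1" "0 < (d / b)\<^sup>2"
    using \<open>d \<le> b\<close> \<open>d > 0\<close> b(1) by (auto simp: power_le_one)
  then have r: "0 \<le> r" "r < 1" "r\<^sup>2 = 1 - (d / b)\<^sup>2"
    by (auto simp: r_def)
  have "\<exists>S. pos_def S \<and> S ** S = mat 1 - (mat 1 - c *\<^sub>R P)"
  proof (rule sqrt_one_minus [OF _ r(1,2)])
    show "cadj (mat 1 - c *\<^sub>R P) = mat 1 - c *\<^sub>R P"
      by (simp add: cadj_diff cadj_scaleR P(1))
    fix x :: "complex^'n"
    show "norm ((mat 1 - c *\<^sub>R P) *v x) \<le> r * norm x"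
    proof (rule power2_le_imp_le)
      have "(norm ((mat 1 - c *\<^sub>R P) *v x))\<^sup>2
          = (norm x)\<^sup>2 - 2 * c * (x \<bullet> (P *v x)) + c\<^sup>2 * (norm (P *v x))\<^sup>2"
        unfolding power2_norm_eq_inner
        by (simp add: matrix_vector_mult_diff_rdistrib scaleR_mult_vector
            inner_diff_left inner_diff_right inner_commute power2_eq_square algebra_simps)
      also have "\<dots> \<le> (norm x)\<^sup>2 - 2 * c * (d * (norm x)\<^sup>2) + c\<^sup>2 * (b * norm x)\<^sup>2"
        using \<open>c > 0\<close> lower [of x] b(2) [of x]
        by (intro add_mono diff_mono mult_left_mono power_mono) auto
      also have "\<dots> = (r * norm x)\<^sup>2"
        unfolding power_mult_distrib r(3) c_def
        using b(1) by (simp add: power2_eq_square field_simps)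
      finally show "(norm ((mat 1 - c *\<^sub>R P) *v x))\<^sup>2 \<le> (r * norm x)\<^sup>2" .
    qed (use r in simp)
  qed
  then obtain S where S: "pos_def S" "S ** S = c *\<^sub>R P"
    by auto
  have "pos_def ((1 / sqrt c) *\<^sub>R S)"
    using S(1) \<open>c > 0\<close>
    by (simp add: pos_def_iff cadj_scaleR scaleR_mult_vector)
  moreover have "((1 / sqrt c) *\<^sub>R S) ** ((1 / sqrt c) *\<^sub>R S) = P"
    using S(2) \<open>c > 0\<close> by (simp add: matrix_scalar_ac scalar_matrix_assoc [symmetric])
  ultimately show ?thesis by blast
qed

text \<open>For two square roots and \<open>X = S - T\<close> one has \<open>X\<^sup>* S X + X\<^sup>* X T = 0\<close>. The traces of both
  summands are sums of values of the forms of \<open>S\<close> and \<open>T\<close> (for the second one after a cyclic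
  permutation), so all of them vanish and \<open>X = 0\<close>.\<close>

lemma pos_def_sqrt_unique:
  fixes S T :: "complex^'n^'n"
  assumes S: "pos_def S" and T: "pos_def T" and eq: "S ** S = T ** T"
  shows "S = T"
proof -
  define X where "X = S - T"
  have tr: "Re (trace (cadj M ** N ** M)) = (\<Sum>j\<in>UNIV. column j M \<bullet> (N *v column j M))"
    for M N :: "complex^'n^'n"
  proof -
    have "(cadj M ** N ** M) $ j $ j = hform N (column j M)" for j
      by (simp add: hform_def cadj_def column_def matrix_matrix_mult_def sum_distrib_right)
        (rule sum.swap)
    then show ?thesis
      by (simp add: trace_def Re_hform)
  qed
  have nonneg: "0 \<le> x \<bullet> (N *v x)" if "pos_def N" for N :: "complex^'n^'n" and x
    using that by (cases "x = 0") (auto simp: pos_def_iff less_imp_le)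
  have "cadj X = X"
    using S T by (simp add: X_def cadj_diff pos_def_cadj)
  have "S ** X + X ** T = 0"
    using eq by (simp add: X_def matrix_distribs)
  then have "cadj X ** (S ** X + X ** T) = 0"
    by simp
  then have "cadj X ** S ** X + cadj X ** X ** T = 0"
    by (simp add: matrix_add_ldistrib matrix_mul_assoc)
  then have "trace (cadj X ** S ** X) + trace (cadj X ** X ** T) = 0"
    unfolding trace_add [symmetric] by (simp add: trace_def)
  moreover have "trace (cadj X ** X ** T) = trace (cadj (cadj X) ** T ** cadj X)"
    using trace_mul_sym [of "cadj X" "X ** T"] by (simp add: matrix_mul_assoc)
  ultimately have "trace (cadj X ** S ** X) + trace (cadj (cadj X) ** T ** cadj X) = 0"
    by (simp only:)
  then have "Re (trace (cadj X ** S ** X)) + Re (trace (cadj (cadj X) ** T ** cadj X)) = 0"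
    by (simp only: complex_eq_iff plus_complex.sel zero_complex.sel)
  moreover have "0 \<le> (\<Sum>j\<in>UNIV. column j M \<bullet> (N *v column j M))"
    if "pos_def N" for M N :: "complex^'n^'n"
    using nonneg [OF that] by (simp add: sum_nonneg)
  ultimately have sum0: "(\<Sum>j\<in>UNIV. column j X \<bullet> (S *v column j X)) = 0"
    unfolding tr using S T by (simp add: add_nonneg_eq_0_iff)
  have "column j X = 0" for j
  proof (rule ccontr)
    assume "column j X \<noteq> 0"
    then have "0 < column j X \<bullet> (S *v column j X)"
      using S by (simp add: pos_def_iff)
    moreover have "column j X \<bullet> (S *v column j X) = 0"
      using sum0 nonneg [OF S] by (subst (asm) sum_nonneg_eq_0_iff) auto
    ultimately show False by simp
  qed
  then have "X = 0"
    by (simp add: column_def vec_eq_iff)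
  then show ?thesis
    by (simp add: X_def)
qed

lemma hsqrt_props:
  assumes "pos_def P"
  shows "pos_def (hsqrt P) \<and> hsqrt P ** hsqrt P = P"
proof -
  have "\<exists>!S. pos_def S \<and> S ** S = P"
  proof (rule ex_ex1I)
    show "\<exists>S. pos_def S \<and> S ** S = P"
      by (rule pos_def_sqrt_exists [OF assms])
    show "S = T" if "pos_def S \<and> S ** S = P" "pos_def T \<and> T ** T = P" for S T
      by (rule pos_def_sqrt_unique) (use that in auto)
  qed
  then show ?thesis
    unfolding hsqrt_def by (rule theI')
qed

lemmas pos_def_hsqrt = hsqrt_props [THEN conjunct1]
  and hsqrt_mult_self = hsqrt_props [THEN conjunct2]

lemma hsqrt_invertible: "pos_def P \<Longrightarrow> invertible (hsqrt P)"
  by (simp add: pos_def_hsqrt pos_def_invertible)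

lemma cadj_hsqrt: "pos_def P \<Longrightarrow> cadj (hsqrt P) = hsqrt P"
  by (simp add: pos_def_hsqrt pos_def_cadj)

lemma cadj_inv_hsqrt: "pos_def P \<Longrightarrow> cadj (matrix_inv (hsqrt P)) = matrix_inv (hsqrt P)"
  by (simp add: cadj_matrix_inv hsqrt_invertible cadj_hsqrt)


section \<open>Block matrices\<close>

lemma sum_UNIV_Plus: "sum f (UNIV :: ('a::finite + 'b::finite) set) = (\<Sum>i\<in>UNIV. f (Inl i)) + (\<Sum>j\<in>UNIV. f (Inr j))"
  by (simp add: sum.Plus flip: UNIV_Plus_UNIV)

lemma block_mat_eqI:
  assumes "block11 M = block11 N" "block12 M = block12 N" "block21 M = block21 N" "block22 M = block22 N"
  shows "M = N"
proof -
  have "M $ i $ j = N $ i $ j" for i j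
    using assms by (cases i; cases j) (simp_all add: block11_def block12_def block21_def block22_def vec_eq_iff)
  then show ?thesis
    by (simp add: vec_eq_iff)
qed

lemmas block_defs = block_mat_def vcat_def hcat_def
  block11_def block12_def block21_def block22_def

lemma block_of_block_mat [simp]:
  "block11 (block_mat A B C D) = A" "block12 (block_mat A B C D) = B"
  "block21 (block_mat A B C D) = C" "block22 (block_mat A B C D) = D"
  by (simp_all add: block_defs vec_eq_iff)

lemma block_mat_blocks [simp]: "block_mat (block11 M) (block12 M) (block21 M) (block22 M) = M"
  by (rule block_mat_eqI) simp_all

lemma block_mat_inject [simp]:
  "block_mat A B C D = block_mat A' B' C' D' \<longleftrightarrow> A = A' \<and> B = B' \<and> C = C' \<and> D = D'"
  by (metis block_of_block_mat)

lemma vcat_inject [simp]: "vcat A B = vcat A' B' \<longleftrightarrow> A = A' \<and> B = B'"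
proof
  assume eq: "vcat A B = vcat A' B'"
  have "A $ i = A' $ i" for i
    using arg_cong [OF eq, of "\<lambda>M. M $ Inl i"] by (simp add: vcat_def)
  moreover have "B $ i = B' $ i" for i
    using arg_cong [OF eq, of "\<lambda>M. M $ Inr i"] by (simp add: vcat_def)
  ultimately show "A = A' \<and> B = B'"
    by (simp add: vec_eq_iff)
qed simp

lemma block_mat_mult:
  fixes A :: "complex^('k::finite)^('r::finite)" and D :: "complex^('l::finite)^('s::finite)"
    and A' :: "complex^('c::finite)^'k" and D' :: "complex^('d::finite)^'l"
  shows "block_mat A B C D ** block_mat A' B' C' D' =
    block_mat (A ** A' + B ** C') (A ** B' + B ** D') (C ** A' + D ** C') (C ** B' + D ** D')"
  by (rule block_mat_eqI) (simp_all add: block_defs vec_eq_iff matrix_matrix_mult_def sum_UNIV_Plus)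

lemma block_mat_vcat:
  fixes A :: "complex^('k::finite)^('r::finite)" and D :: "complex^('l::finite)^('s::finite)"
  shows "block_mat A B C D ** vcat M N = vcat (A ** M + B ** N) (C ** M + D ** N)"
  by (simp add: block_defs vec_eq_iff matrix_matrix_mult_def sum_UNIV_Plus split: sum.splits)

lemma hcat_block_mat:
  fixes A :: "complex^('k::finite)^('r::finite)" and B :: "complex^('l::finite)^'r"
  shows "hcat A B ** block_mat M N M' N' = hcat (A ** M + B ** M') (A ** N + B ** N')"
  by (simp add: block_defs vec_eq_iff matrix_matrix_mult_def sum_UNIV_Plus split: sum.splits)

lemma vcat_mult:
  fixes A :: "complex^('k::finite)^('r::finite)" and B :: "complex^'k^('s::finite)"
  shows "vcat A B ** M = vcat (A ** M) (B ** M)"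
  by (simp add: block_defs vec_eq_iff matrix_matrix_mult_def split: sum.splits)

lemma vcat_mult_hcat:
  fixes A :: "complex^('k::finite)^('r::finite)" and B :: "complex^'k^('s::finite)"
    and M :: "complex^('l::finite)^'k" and C :: "complex^('c::finite)^'l"
  shows "vcat A B ** M ** hcat C D = block_mat (A ** M ** C) (A ** M ** D) (B ** M ** C) (B ** M ** D)"
  unfolding vcat_mult
  by (rule block_mat_eqI) (simp_all add: block_defs vec_eq_iff matrix_matrix_mult_def)

lemma block_mat_add: "block_mat A B C D + block_mat A' B' C' D' =
    block_mat (A + A') (B + B') (C + C') (D + D')"
  by (rule block_mat_eqI) (simp_all add: block_defs vec_eq_iff)

lemma cadj_block_mat: "cadj (block_mat A B C D) = block_mat (cadj A) (cadj C) (cadj B) (cadj D)"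
  by (rule block_mat_eqI) (simp_all add: block_defs cadj_def vec_eq_iff)

lemma mat_block: "(mat z :: complex^('a::finite + 'b::finite)^('a + 'b)) = block_mat (mat z) 0 0 (mat z)"
  by (rule block_mat_eqI) (simp_all add: block_defs mat_def vec_eq_iff)

text \<open>If the last block column is \<open>[0; I]\<close>, then the columns before it, being orthogonal to it, vanish
  in the last block row.\<close>

lemma unitary_fixing_block:
  assumes M: "unitary M" and fix2: "block12 M = 0" "block22 M = mat 1"
  shows "\<exists>F. unitary F \<and> M = block_mat F 0 0 (mat 1)"
proof -
  obtain F L where M_eq: "M = block_mat F 0 L (mat 1)"
    by (metis block_mat_blocks fix2)
  have "cadj F ** F + cadj L ** L = mat 1" "L = 0"
    using M by (auto simp add: unitary_def M_eq cadj_block_mat block_mat_mult mat_block)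
  then show ?thesis
    by (auto simp: M_eq intro!: unitaryI)
qed

lemma unitary_block_diag:
  "unitary F \<Longrightarrow> unitary H \<Longrightarrow> unitary (block_mat F 0 0 H)"
  by (simp add: unitary_def cadj_block_mat block_mat_mult mat_block)


section \<open>Resolvents of stable matrices\<close>

lemma stable_invertible_outside:
  assumes "stable A" "1 \<le> cmod z"
  shows "invertible (mat z - A)"
  unfolding invertible_iff_ker
proof (intro allI impI)
  fix x assume "(mat z - A) *v x = 0"
  then have "A *v x = z *s x"
    by (simp add: matrix_vector_mult_diff_rdistrib mat_vector_mult)
  then show "x = 0"
    using assms by (force simp: stable_def)
qed

lemma stable_invertible_inside:
  assumes "stable A" "cmod z \<le> 1"
  shows "invertible (mat 1 - mat z ** A)"
proof (cases "z = 0")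
  case False
  then have "1 \<le> cmod (1 / z)"
    using assms by (simp add: norm_divide)
  then have "invertible (mat (1 / z) - A)"
    by (rule stable_invertible_outside [OF assms(1)])
  moreover have "invertible (mat z :: complex^'a^'a)"
    by (rule invertibleI [where N = "mat (1 / z)"]) (simp add: mat_mult_mat False)
  ultimately have "invertible (mat z ** (mat (1 / z) - A))"
    by (rule invertible_mult [rotated])
  then show ?thesis
    by (simp add: matrix_distribs mat_mult_mat False)
qed (simp add: invertibleI [where N = "mat 1"])

lemma stable_cadj_invertible_inside:
  assumes "stable A" "cmod z \<le> 1"
  shows "invertible (mat 1 - mat z ** cadj A)"
proof -
  have "invertible (cadj (mat 1 - mat (cnj z) ** A))"
    using stable_invertible_inside [of A "cnj z"] assms by (simp add: invertible_cadj_iff)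
  then show ?thesis
    by (simp add: cadj_simps mat_commute)
qed

lemma matrix_inv_outside:
  fixes A :: "complex^'n^'n"
  assumes "z \<noteq> 0" "invertible (mat 1 - mat (1 / z) ** A)"
  shows "matrix_inv (mat z - A) = mat (1 / z) ** matrix_inv (mat 1 - mat (1 / z) ** A)"
proof (rule matrix_inv_eqI)
  let ?R = "matrix_inv (mat 1 - mat (1 / z) ** A)"
  have "(mat z - A) ** (mat (1 / z) ** ?R) = (mat (1 / z) ** (mat z - A)) ** ?R"
    by (simp only: matrix_mul_assoc mat_commute [of "mat z - A"])
  also have "mat (1 / z) ** (mat z - A) = mat 1 - mat (1 / z) ** A"
    using assms(1) by (simp add: matrix_diff_ldistrib mat_mult_mat)
  finally show "(mat z - A) ** (mat (1 / z) ** ?R) = mat 1"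
    using assms(2) by (simp add: matrix_inv_right)
qed

text \<open>Cramer's rule; it shows below that the inverse of a holomorphic matrix function is holomorphic.\<close>

lemma matrix_inv_component:
  fixes M :: "complex^'n^'n"
  assumes "invertible M"
  shows "matrix_inv M $ i $ j =
    det (\<chi> a b. if b = i then axis j 1 $ a else M $ a $ b) / det M"
proof -
  have "M *v (matrix_inv M *v axis j 1) = axis j 1"
    by (simp add: matrix_vector_mul_assoc matrix_inv_right assms)
  then have "matrix_inv M *v axis j 1
      = (\<chi> k. det (\<chi> a b. if b = k then axis j 1 $ a else M $ a $ b) / det M)"
    using assms cramer [of M "matrix_inv M *v axis j 1" "axis j 1"]
    by (simp add: invertible_det_nz)
  moreover have "(matrix_inv M *v axis j 1) $ i = matrix_inv M $ i $ j"
    by (simp add: matrix_vector_mult_def axis_def if_distrib [of "\<lambda>x. _ * x"] cong: if_cong)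
  ultimately show ?thesis
    by simp
qed

lemma holomorphic_on_det:
  fixes M :: "complex \<Rightarrow> complex^'n^'n"
  assumes "\<And>i j. (\<lambda>z. M z $ i $ j) holomorphic_on s"
  shows "(\<lambda>z. det (M z)) holomorphic_on s"
  unfolding det_def by (intro holomorphic_intros assms)

lemma holomorphic_on_matrix_inv:
  fixes M :: "complex \<Rightarrow> complex^'n^'n"
  assumes "\<And>i j. (\<lambda>z. M z $ i $ j) holomorphic_on s" and inv: "\<And>z. z \<in> s \<Longrightarrow> invertible (M z)"
  shows "(\<lambda>z. matrix_inv (M z) $ i $ j) holomorphic_on s"
proof -
  have "(\<lambda>z. (\<chi> a b. if b = i then axis j 1 $ a else M z $ a $ b) $ a $ b) holomorphic_on s"
    for a b
    using assms(1) by (cases "b = i") simp_all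
  then have "(\<lambda>z. det (\<chi> a b. if b = i then axis j 1 $ a else M z $ a $ b) / det (M z))
      holomorphic_on s"
    using inv by (intro holomorphic_intros holomorphic_on_det assms(1)) (auto simp: invertible_det_nz)
  then show ?thesis
    by (rule holomorphic_transform) (simp add: matrix_inv_component inv)
qed


section \<open>Integrals over the unit circle\<close>

lemma circle_integral_holomorphic:
  assumes f: "f holomorphic_on cball 0 1"
  shows "(f has_contour_integral 0) (circlepath 0 1)"
proof -
  have holo: "(\<lambda>u. u * f u) holomorphic_on cball 0 1"
    by (intro holomorphic_intros f)
  have "((\<lambda>u. u * f u / (u - 0)) has_contour_integral (2 * of_real pi * \<i> * (0 * f 0)))
      (circlepath 0 1)"
    by (rule Cauchy_integral_circlepath)
      (use holo in \<open>auto intro: holomorphic_on_imp_continuous_on holomorphic_on_subset\<close>)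
  then have "((\<lambda>u. u * f u / (u - 0)) has_contour_integral 0) (circlepath 0 1)"
    by (simp only: mult_zero_left mult_zero_right)
  then show ?thesis
    by (rule has_contour_integral_eq) auto
qed

text \<open>The substitution \<open>z = 1 / u\<close> maps the unit circle to itself and turns the mean value
  property of a function that is holomorphic inside into one for functions outside.\<close>

lemma circle_integral_reciprocal:
  assumes f: "f holomorphic_on cball 0 1"
  shows "((\<lambda>z. f (1 / z) / z) has_contour_integral (2 * of_real pi * \<i> * f 0)) (circlepath 0 1)"
proof -
  have "((\<lambda>u. f u / (u - 0)) has_contour_integral (2 * of_real pi * \<i> * f 0)) (circlepath 0 1)"
    by (rule Cauchy_integral_circlepath)
      (use f in \<open>auto intro: holomorphic_on_imp_continuous_on holomorphic_on_subset\<close>)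
  then have "((\<lambda>t. f (cis t) * \<i>) has_integral (2 * of_real pi * \<i> * f 0)) {0..2 * pi}"
    by (simp add: circlepath_def has_contour_integral_part_circlepath_iff)
  then have "((\<lambda>t. f (cis (2 * pi - t)) * \<i>) has_integral (2 * of_real pi * \<i> * f 0))
      ((-) (2 * pi) ` {0..2 * pi})"
    using has_integral_affinity [where m = "- 1" and c = "2 * pi" and a = 0 and b = "2 * pi"
        and f = "\<lambda>t. f (cis t) * \<i>" and i = "2 * of_real pi * \<i> * f 0"]
    by (simp add: algebra_simps)
  then have "((\<lambda>t. f (cis (2 * pi - t)) * \<i>) has_integral (2 * of_real pi * \<i> * f 0)) {0..2 * pi}"
    by simp
  moreover have "cis (2 * pi - t) = 1 / cis t" for t
    by (simp add: cis_divide [symmetric])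
  ultimately show ?thesis
    by (simp add: circlepath_def has_contour_integral_part_circlepath_iff)
qed

text \<open>Normalized by \<open>2 \<pi> \<i>\<close>, as in the definition of \<open>V\<close>; the resolvent of a stable matrix then has
  integral \<open>I\<close>.\<close>

definition has_circle_integral :: "(complex \<Rightarrow> complex^'n^'m) \<Rightarrow> complex^'n^'m \<Rightarrow> bool" where
  "has_circle_integral F I \<longleftrightarrow>
    (\<forall>i j. ((\<lambda>z. F z $ i $ j) has_contour_integral (2 * of_real pi * \<i> * I $ i $ j)) (circlepath 0 1))"

lemma has_circle_integral_unique:
  assumes "has_circle_integral F I" "has_circle_integral F I'"
  shows "I = I'"
proof -
  have "2 * of_real pi * \<i> * I $ i $ j = 2 * of_real pi * \<i> * I' $ i $ j" for i j
    using assms has_contour_integral_unique unfolding has_circle_integral_def by blast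
  then show ?thesis
    by (simp add: vec_eq_iff)
qed

lemma has_circle_integral_add:
  "has_circle_integral F I \<Longrightarrow> has_circle_integral F' I' \<Longrightarrow>
    has_circle_integral (\<lambda>z. F z + F' z) (I + I')"
  by (simp add: has_circle_integral_def distrib_left has_contour_integral_add)

lemma has_circle_integral_lmult:
  assumes "has_circle_integral F I"
  shows "has_circle_integral (\<lambda>z. M ** F z) (M ** I)"
proof -
  have "((\<lambda>z. \<Sum>k\<in>UNIV. M $ i $ k * F z $ k $ j) has_contour_integral
      (\<Sum>k\<in>UNIV. M $ i $ k * (2 * of_real pi * \<i> * I $ k $ j))) (circlepath 0 1)" for i j
    using assms unfolding has_circle_integral_def
    by (intro has_contour_integral_sum has_contour_integral_lmul) auto
  then show ?thesis
    by (simp add: has_circle_integral_def matrix_matrix_mult_def sum_distrib_left mult_ac)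
qed

lemma has_circle_integral_rmult:
  assumes "has_circle_integral F I"
  shows "has_circle_integral (\<lambda>z. F z ** M) (I ** M)"
proof -
  have "((\<lambda>z. \<Sum>k\<in>UNIV. F z $ i $ k * M $ k $ j) has_contour_integral
      (\<Sum>k\<in>UNIV. (2 * of_real pi * \<i> * I $ i $ k) * M $ k $ j)) (circlepath 0 1)" for i j
    using assms unfolding has_circle_integral_def
    by (intro has_contour_integral_sum has_contour_integral_rmul) auto
  then show ?thesis
    by (simp add: has_circle_integral_def matrix_matrix_mult_def sum_distrib_left mult_ac)
qed

lemma has_circle_integral_eq:
  assumes "has_circle_integral F I" "\<And>z. cmod z = 1 \<Longrightarrow> F z = F' z"
  shows "has_circle_integral F' I"
  unfolding has_circle_integral_def
proof (intro allI)
  fix i j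
  show "((\<lambda>z. F' z $ i $ j) has_contour_integral 2 * of_real pi * \<i> * I $ i $ j) (circlepath 0 1)"
  proof (rule has_contour_integral_eq)
    show "((\<lambda>z. F z $ i $ j) has_contour_integral 2 * of_real pi * \<i> * I $ i $ j) (circlepath 0 1)"
      using assms(1) by (simp add: has_circle_integral_def)
  qed (simp add: assms(2))
qed

lemma circle_integral_resolvent:
  assumes "stable W"
  shows "has_circle_integral (\<lambda>z. matrix_inv (mat z - W)) (mat 1)"
proof -
  define F where "F z = matrix_inv (mat 1 - mat z ** W)" for z
  have "has_circle_integral (\<lambda>z. mat (1 / z) ** F (1 / z)) (F 0)"
    unfolding has_circle_integral_def
  proof (intro allI)
    fix i j
    have "(\<lambda>z. F z $ i $ j) holomorphic_on cball 0 1"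
      unfolding F_def
      by (intro holomorphic_on_matrix_inv)
        (auto simp: mat_mult_component stable_invertible_inside assms intro!: holomorphic_intros)
    from circle_integral_reciprocal [OF this]
    show "((\<lambda>z. (mat (1 / z) ** F (1 / z)) $ i $ j) has_contour_integral
        2 * of_real pi * \<i> * F 0 $ i $ j) (circlepath 0 1)"
      by (simp add: mat_mult_component)
  qed
  moreover have "F 0 = mat 1"
    unfolding F_def by (rule matrix_inv_eqI) simp
  ultimately have "has_circle_integral (\<lambda>z. mat (1 / z) ** F (1 / z)) (mat 1)"
    by simp
  then show ?thesis
  proof (rule has_circle_integral_eq)
    fix z :: complex assume "cmod z = 1"
    then show "mat (1 / z) ** F (1 / z) = matrix_inv (mat z - W)"
      unfolding F_def
      by (subst matrix_inv_outside) (auto intro!: stable_invertible_inside assms simp: norm_divide)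
  qed
qed

lemma circle_integral_resolvent_cadj:
  assumes "stable A"
  shows "has_circle_integral (\<lambda>z. matrix_inv (mat 1 - mat z ** cadj A)) 0"
  unfolding has_circle_integral_def
  by (auto simp: mat_mult_component stable_cadj_invertible_inside assms
      intro!: holomorphic_intros circle_integral_holomorphic holomorphic_on_matrix_inv)


section \<open>The Stein equation\<close>

text \<open>From \<open>R = (I - z A\<^sup>*) Q + A\<^sup>* Q (z I - W)\<close> the function \<open>(I - z A\<^sup>*)\<^sup>-\<^sup>1 R (z I - W)\<^sup>-\<^sup>1\<close> is a
  sum of a function that is holomorphic inside the unit circle and one that is holomorphic
  outside. The integral over the circle retains the second one only.\<close>

lemma stein_resolvent:
  fixes A W Q :: "complex^'n^'n"
  assumes Q: "Q - cadj A ** Q ** W = R"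
    and "invertible (mat 1 - mat z ** cadj A)" "invertible (mat z - W)"
  shows "matrix_inv (mat 1 - mat z ** cadj A) ** R ** matrix_inv (mat z - W)
    = Q ** matrix_inv (mat z - W) + matrix_inv (mat 1 - mat z ** cadj A) ** cadj A ** Q"
proof -
  let ?a = "mat 1 - mat z ** cadj A" and ?w = "mat z - W"
  have R: "R = ?a ** Q + cadj A ** Q ** ?w"
    unfolding Q [symmetric] by (simp add: matrix_distribs mat_commute matrix_mul_assoc)
  have "matrix_inv ?a ** R ** matrix_inv ?w
      = (matrix_inv ?a ** ?a) ** Q ** matrix_inv ?w
        + matrix_inv ?a ** cadj A ** Q ** (?w ** matrix_inv ?w)"
    unfolding R by (simp add: matrix_add_ldistrib matrix_add_rdistrib matrix_mul_assoc)
  then show ?thesis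
    by (simp only: assms matrix_inv_left matrix_inv_right matrix_mul_lid matrix_mul_rid)
qed

lemma stein_unique_zero:
  fixes A W Q :: "complex^'n^'n"
  assumes "stable A" "stable W" "Q - cadj A ** Q ** W = 0"
  shows "Q = 0"
proof -
  let ?Ra = "\<lambda>z. matrix_inv (mat 1 - mat z ** cadj A)" and ?Rw = "\<lambda>z. matrix_inv (mat z - W)"
  have "has_circle_integral (\<lambda>z. Q ** ?Rw z + ?Ra z ** (cadj A ** Q)) (Q ** mat 1 + 0 ** (cadj A ** Q))"
    by (intro has_circle_integral_add has_circle_integral_lmult has_circle_integral_rmult
        circle_integral_resolvent circle_integral_resolvent_cadj assms)
  then have "has_circle_integral (\<lambda>z. Q ** ?Rw z + ?Ra z ** (cadj A ** Q)) Q"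
    by simp
  then have "has_circle_integral (\<lambda>z. 0) Q"
  proof (rule has_circle_integral_eq)
    fix z :: complex assume "cmod z = 1"
    then show "Q ** ?Rw z + ?Ra z ** (cadj A ** Q) = 0"
      using stein_resolvent [OF assms(3), of z] assms
      by (simp add: stable_invertible_outside stable_cadj_invertible_inside matrix_mul_assoc)
  qed
  moreover have "has_circle_integral (\<lambda>z. 0 :: complex^'n^'n) 0"
    by (simp add: has_circle_integral_def has_contour_integral_0)
  ultimately show ?thesis
    by (rule has_circle_integral_unique)
qed

text \<open>The Stein operator is an endomorphism of a finite-dimensional space, so injectivity suffices.\<close>

lemma stein_ex1:
  fixes A W R :: "complex^'n^'n"
  assumes "stable A" "stable W"
  shows "\<exists>!Q. Q - cadj A ** Q ** W = R"
proof -
  define f where "f Q = Q - cadj A ** Q ** W" for Q :: "complex^'n^'n"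
  have lin: "linear f"
    by (rule linearI)
      (simp_all add: f_def matrix_distribs algebra_simps scalar_matrix_assoc [symmetric] matrix_scalar_ac)
  have "inj f"
    using stein_unique_zero [OF assms] by (simp add: linear_injective_0 [OF lin] f_def)
  moreover have "surj f"
    using linear_inj_imp_surj [OF lin \<open>inj f\<close>] .
  ultimately have "\<exists>!Q. f Q = R"
    by (metis injD surjD)
  then show ?thesis
    by (simp add: f_def)
qed

lemma stein_sol:
  "stable A \<Longrightarrow> stable W \<Longrightarrow> stein_sol A W R - cadj A ** stein_sol A W R ** W = R"
  unfolding stein_sol_def by (rule theI') (rule stein_ex1)

lemma stein_sol_eqI:
  "stable A \<Longrightarrow> stable W \<Longrightarrow> Q - cadj A ** Q ** W = R \<Longrightarrow> stein_sol A W R = Q"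
  unfolding stein_sol_def by (rule the1_equality) (rule stein_ex1)

text \<open>On the unit circle \<open>G\<^sup>\<sharp>(z) = D\<^sup>* + z B\<^sup>* (I - z A\<^sup>*)\<^sup>-\<^sup>1 C\<^sup>*\<close>. With the splitting of
  \<open>(I - z A\<^sup>*)\<^sup>-\<^sup>1 C\<^sup>* U (z I - W)\<^sup>-\<^sup>1\<close> above, the integrand becomes \<open>V (z I - W)\<^sup>-\<^sup>1\<close> up to a function
  that is holomorphic inside.\<close>

lemma chart_V_eq:
  fixes A W Q :: "complex^'n^'n"
  assumes A: "stable A" and W: "stable W" and G: "realization G A B C D"
    and Q: "Q - cadj A ** Q ** W = cadj C ** U"
  shows "chart_V U W G = cadj D ** U + cadj B ** Q ** W"
proof -
  let ?Ra = "\<lambda>z. matrix_inv (mat 1 - mat z ** cadj A)" and ?Rw = "\<lambda>z. matrix_inv (mat z - W)"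
  let ?V = "cadj D ** U + cadj B ** Q ** W"
  define bad where "bad = {z. G z \<noteq> D + C ** matrix_inv (mat z - A) ** B}"
  have "finite bad"
    using G by (simp add: realization_def eq_rational_def bad_def)
  have "has_circle_integral (\<lambda>z. ?V ** ?Rw z + cadj B ** (?Ra z ** Q)) (?V ** mat 1 + cadj B ** (0 ** Q))"
    by (intro has_circle_integral_add has_circle_integral_lmult has_circle_integral_rmult
        circle_integral_resolvent circle_integral_resolvent_cadj A W)
  then have V: "has_circle_integral (\<lambda>z. ?V ** ?Rw z + cadj B ** (?Ra z ** Q)) ?V"
    by simp
  have integrand: "sharp G z ** U ** ?Rw z = ?V ** ?Rw z + cadj B ** (?Ra z ** Q)"
    if z: "cmod z = 1" "z \<notin> bad" for z
  proof -
    have "z \<noteq> 0" "z * cnj z = 1"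
      using z(1) complex_norm_square [of z] by auto
    then have "1 / cnj z = z" "cnj z = 1 / z"
      by (auto simp: divide_eq_eq eq_divide_eq mult.commute)
    have invA: "invertible (mat z - A)" and inva: "invertible (mat 1 - mat z ** cadj A)"
      and invw: "invertible (mat z - W)"
      using z A W by (simp_all add: stable_invertible_outside stable_cadj_invertible_inside)
    have "cadj (matrix_inv (mat z - A)) = matrix_inv (mat (1 / z) - cadj A)"
      using invA \<open>cnj z = 1 / z\<close> by (simp add: cadj_matrix_inv cadj_simps)
    also have "\<dots> = mat z ** ?Ra z"
      using matrix_inv_outside [of "1 / z" "cadj A"] inva \<open>z \<noteq> 0\<close> by simp
    finally have "sharp G z = cadj D + cadj B ** (mat z ** ?Ra z ** cadj C)"
      using z(2) by (simp add: sharp_def \<open>1 / cnj z = z\<close> bad_def cadj_simps matrix_mul_assoc)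
    then have "sharp G z ** U ** ?Rw z
        = cadj D ** U ** ?Rw z + cadj B ** (mat z ** (?Ra z ** (cadj C ** U) ** ?Rw z))"
      by (simp add: matrix_distribs matrix_mul_assoc)
    also have "?Ra z ** (cadj C ** U) ** ?Rw z = Q ** ?Rw z + ?Ra z ** cadj A ** Q"
      by (rule stein_resolvent [OF Q inva invw])
    also have "mat z ** (Q ** ?Rw z + ?Ra z ** cadj A ** Q)
        = Q ** (mat z ** ?Rw z) + (?Ra z ** (mat z ** cadj A)) ** Q"
      by (simp add: matrix_add_ldistrib matrix_mul_assoc mat_commute)
    also have "mat z ** ?Rw z = mat 1 + W ** ?Rw z"
      using matrix_inv_right [OF invw] by (simp add: matrix_diff_rdistrib algebra_simps)
    also have "?Ra z ** (mat z ** cadj A) = ?Ra z - mat 1"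
      using matrix_inv_left [OF inva] by (simp add: matrix_diff_ldistrib algebra_simps)
    finally show ?thesis
      by (simp add: matrix_distribs matrix_mul_assoc)
  qed
  have "chart_V U W G $ i $ j = ?V $ i $ j" for i j
  proof -
    have "contour_integral (circlepath 0 1) (\<lambda>z. (sharp G z ** U ** ?Rw z) $ i $ j)
        = contour_integral (circlepath 0 1) (\<lambda>z. (?V ** ?Rw z + cadj B ** (?Ra z ** Q)) $ i $ j)"
      by (rule contour_integral_spike_finite_simple_path [OF \<open>finite bad\<close>])
        (auto simp: simple_path_circlepath integrand simp del: vector_add_component)
    also have "\<dots> = 2 * of_real pi * \<i> * ?V $ i $ j"
      by (rule contour_integral_unique) (use V in \<open>simp only: has_circle_integral_def\<close>)
    finally show ?thesis
      by (simp add: chart_V_def)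
  qed
  then show ?thesis
    by (simp add: vec_eq_iff)
qed


section \<open>Balanced realizations\<close>

lemma norm_scalar_vector_mult: "norm (z *s (x :: complex^'n)) = cmod z * norm x"
  by (simp add: norm_vec_def norm_mult L2_set_right_distrib)

text \<open>The exceptional points are the roots of the characteristic polynomial, which does not vanish at
  a point beyond a bound \<open>b\<close> of the operator.\<close>

lemma finite_not_invertible:
  fixes A :: "complex^'n^'n"
  shows "finite {z. \<not> invertible (mat z - A)}"
proof -
  define p where "p = (\<Sum>s | s permutes (UNIV :: 'n set).
    of_int (sign s) * (\<Prod>i\<in>UNIV. [:- A $ i $ s i, if i = s i then 1 else 0:]))"
  have p: "poly p z = det (mat z - A)" for z
  proof -
    have "poly [:- A $ i $ s i, if i = s i then 1 else 0:] z = (mat z - A) $ i $ s i" for i s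
      by (simp add: mat_def)
    then show ?thesis
      unfolding p_def det_def by (simp add: poly_sum poly_prod del: poly_pCons)
  qed
  obtain b where b: "b > 0" "\<And>x. norm (A *v x) \<le> b * norm x"
    using bounded_linear.pos_bounded [OF matrix_vector_mul_bounded_linear [of A]]
    by (auto simp: mult.commute)
  have "invertible (mat (complex_of_real (b + 1)) - A)"
    unfolding invertible_iff_ker
  proof (intro allI impI)
    fix x assume "(mat (complex_of_real (b + 1)) - A) *v x = 0"
    then have "A *v x = complex_of_real (b + 1) *s x"
      by (simp only: matrix_vector_mult_diff_rdistrib mat_vector_mult eq_iff_diff_eq_0 [of _ "A *v x", symmetric])
    then have "norm (A *v x) = (b + 1) * norm x"
      using b(1) by (simp only: norm_scalar_vector_mult norm_of_real)
    then have "norm x \<le> 0"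
      using b(2) [of x] by (simp add: distrib_right)
    then show "x = 0"
      by simp
  qed
  then have "p \<noteq> 0"
    using p invertible_det_nz by (metis poly_0)
  then have "finite {z. poly p z = 0}"
    by (rule poly_roots_finite)
  then show ?thesis
    by (simp add: p invertible_det_nz)
qed

text \<open>An eigenvector \<open>v\<close> of \<open>A\<close> in the kernel of \<open>C\<close> is invisible in the output. Passing to the
  quotient of the state space by its span gives a smaller realization: choose a coordinate \<open>i\<^sub>0\<close>
  with \<open>v\<^sub>i\<^sub>0 \<noteq> 0\<close> and represent every class by its element with vanishing \<open>i\<^sub>0\<close>-th coordinate.\<close>

lemma unobservable_reduction:
  fixes A :: "complex^'n^'n" and B :: "complex^'m^'n" and C :: "complex^'n^'p"
  assumes G: "realization G A B C D" and v: "v \<noteq> 0" "A *v v = l *s v" "C *v v = 0"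
  shows "has_realization_of_dim G (CARD('n) - 1)"
proof -
  obtain i0 where i0: "v $ i0 \<noteq> 0"
    using v(1) by (auto simp: vec_eq_iff)
  define w where "w j = v $ j / v $ i0" for j
  have w: "w i0 = 1" "(\<Sum>k\<in>UNIV. A $ j $ k * w k) = l * w j" "(\<Sum>k\<in>UNIV. C $ a $ k * w k) = 0"
    for j a
  proof -
    show "w i0 = 1"
      using i0 by (simp add: w_def)
    have "(A *v v) $ j = l * v $ j" "(C *v v) $ a = 0"
      by (simp_all add: v)
    then show "(\<Sum>k\<in>UNIV. A $ j $ k * w k) = l * w j" "(\<Sum>k\<in>UNIV. C $ a $ k * w k) = 0"
      using i0 by (simp_all add: w_def matrix_vector_mult_def flip: sum_divide_distrib)
  qed
  obtain h where "bij_betw h {0..<card (UNIV - {i0})} (UNIV - {i0})"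
    using ex_bij_betw_nat_finite [of "UNIV - {i0}"] by auto
  then have h: "bij_betw h {..<CARD('n) - 1} (UNIV - {i0})"
    by (simp add: card_Diff_singleton lessThan_atLeast0)
  define A' where "A' i k = A $ h i $ h k - w (h i) * A $ i0 $ h k" for i k
  define B' where "B' i b = B $ h i $ b - w (h i) * B $ i0 $ b" for i b
  have "finite {z. \<not> (\<exists>X :: nat \<Rightarrow> 'm \<Rightarrow> complex.
          (\<forall>i<CARD('n) - 1. \<forall>b. z * X i b - (\<Sum>j<CARD('n) - 1. A' i j * X j b) = B' i b) \<and>
          (\<forall>a b. G z $ a $ b = D $ a $ b + (\<Sum>i<CARD('n) - 1. C $ a $ h i * X i b)))}"
    (is "finite {z. \<not> ?P z}")
  proof (rule finite_subset)
    show "finite ({z. \<not> invertible (mat z - A)} \<union> {z. G z \<noteq> D + C ** matrix_inv (mat z - A) ** B})"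
      using G by (simp add: finite_not_invertible realization_def eq_rational_def)
    have "?P z" if inv: "invertible (mat z - A)" and Gz: "G z = D + C ** matrix_inv (mat z - A) ** B" for z
    proof -
      define X where "X = matrix_inv (mat z - A) ** B"
      define y where "y j b = X $ j $ b - w j * X $ i0 $ b" for j b
      have "mat z ** X - A ** X = B"
        using inv by (simp add: X_def matrix_mul_assoc matrix_inv_right flip: matrix_diff_rdistrib)
      then have "(mat z ** X) $ j $ b - (A ** X) $ j $ b = B $ j $ b" for j b
        by (metis vector_minus_component)
      then have X: "(\<Sum>k\<in>UNIV. A $ j $ k * X $ k $ b) = z * X $ j $ b - B $ j $ b" for j b
        unfolding mat_mult_component by (simp add: matrix_matrix_mult_def algebra_simps)
      have reindex: "(\<Sum>k<CARD('n) - 1. c (h k) * y (h k) b) = (\<Sum>k\<in>UNIV. c k * y k b)" for c b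
      proof -
        have "(\<Sum>k<CARD('n) - 1. c (h k) * y (h k) b) = (\<Sum>k\<in>UNIV - {i0}. c k * y k b)"
          by (rule sum.reindex_bij_betw [OF h])
        also have "\<dots> = (\<Sum>k\<in>UNIV. c k * y k b)"
          by (rule sum.mono_neutral_left) (auto simp: y_def w(1))
        finally show ?thesis .
      qed
      have Ay: "(\<Sum>k\<in>UNIV. A $ j $ k * y k b) = z * X $ j $ b - B $ j $ b - l * w j * X $ i0 $ b" for j b
      proof -
        have "(\<Sum>k\<in>UNIV. A $ j $ k * y k b)
            = (\<Sum>k\<in>UNIV. A $ j $ k * X $ k $ b) - (\<Sum>k\<in>UNIV. A $ j $ k * w k) * X $ i0 $ b"
          by (simp add: y_def right_diff_distrib sum_subtractf sum_distrib_right mult.assoc)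
        then show ?thesis by (simp add: X w(2))
      qed
      have Cy: "(\<Sum>k\<in>UNIV. C $ a $ k * y k b) = (C ** X) $ a $ b" for a b
      proof -
        have "(\<Sum>k\<in>UNIV. C $ a $ k * y k b)
            = (\<Sum>k\<in>UNIV. C $ a $ k * X $ k $ b) - (\<Sum>k\<in>UNIV. C $ a $ k * w k) * X $ i0 $ b"
          by (simp add: y_def right_diff_distrib sum_subtractf sum_distrib_right mult.assoc)
        then show ?thesis by (simp add: w(3) matrix_matrix_mult_def)
      qed
      have "z * y (h i) b - (\<Sum>k<CARD('n) - 1. A' i k * y (h k) b) = B' i b" for i b
      proof -
        have "(\<Sum>k<CARD('n) - 1. A' i k * y (h k) b)
            = (\<Sum>k\<in>UNIV. (A $ h i $ k - w (h i) * A $ i0 $ k) * y k b)"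
          unfolding A'_def by (rule reindex)
        also have "\<dots> = (\<Sum>k\<in>UNIV. A $ h i $ k * y k b) - w (h i) * (\<Sum>k\<in>UNIV. A $ i0 $ k * y k b)"
          by (simp add: left_diff_distrib sum_subtractf sum_distrib_left mult.assoc)
        finally have sum: "(\<Sum>k<CARD('n) - 1. A' i k * y (h k) b)
            = (\<Sum>k\<in>UNIV. A $ h i $ k * y k b) - w (h i) * (\<Sum>k\<in>UNIV. A $ i0 $ k * y k b)" .
        show ?thesis
          unfolding sum Ay [of "h i"] Ay [of i0]
          unfolding w(1) B'_def y_def by (simp add: algebra_simps)
      qed
      moreover have "G z $ a $ b = D $ a $ b + (\<Sum>k<CARD('n) - 1. C $ a $ h k * y (h k) b)" for a b
        using reindex [of "\<lambda>k. C $ a $ k" b] by (simp add: Gz Cy X_def matrix_mul_assoc)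
      ultimately show "?P z"
        by (intro exI [of _ "\<lambda>i. y (h i)"]) auto
    qed
    then show "{z. \<not> ?P z} \<subseteq> {z. \<not> invertible (mat z - A)} \<union> {z. G z \<noteq> D + C ** matrix_inv (mat z - A) ** B}"
      by blast
  qed
  then show ?thesis
    unfolding has_realization_of_dim_def
    by (intro exI [of _ A'] exI [of _ B'] exI [of _ "\<lambda>a i. C $ a $ h i"] exI [of _ "\<lambda>a b. D $ a $ b"])
qed

lemma balanced_isometry:
  assumes "unitary (realization_matrix A B C D)"
  shows "cadj C ** C + cadj A ** A = mat 1"
  using assms
  by (simp add: realization_matrix_def unitary_def cadj_block_mat block_mat_mult mat_block)

text \<open>\<open>\<parallel>A v\<parallel>\<^sup>2 + \<parallel>C v\<parallel>\<^sup>2 = \<parallel>v\<parallel>\<^sup>2\<close> excludes eigenvalues outside the closed unit disk, and an eigenvector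
  for an eigenvalue on the circle lies in the kernel of \<open>C\<close>, which contradicts minimality.\<close>

lemma balanced_realization_stable:
  fixes A :: "complex^'n^'n"
  assumes bal: "balanced_realization G A B C D"
  shows "stable A"
  unfolding stable_def
proof (intro allI impI, rule ccontr)
  fix l v assume v: "v \<noteq> 0 \<and> A *v v = l *s v" and l: "\<not> cmod l < 1"
  have "cadj C ** C + cadj A ** A = mat 1"
    using bal balanced_isometry by (auto simp: balanced_realization_def)
  then have "(norm v)\<^sup>2 = v \<bullet> ((cadj C ** C + cadj A ** A) *v v)"
    by (simp add: power2_norm_eq_inner)
  also have "\<dots> = (norm (C *v v))\<^sup>2 + (norm (A *v v))\<^sup>2"
    by (simp add: matrix_vector_mult_add_rdistrib inner_add_right inner_gram)
  finally have "(norm v)\<^sup>2 = (norm (C *v v))\<^sup>2 + (norm (l *s v))\<^sup>2"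
    using v by simp
  moreover have "norm v \<le> norm (l *s v)"
    using l by (simp add: norm_scalar_vector_mult mult_le_cancel_right1)
  then have "(norm v)\<^sup>2 \<le> (norm (l *s v))\<^sup>2"
    by (rule power_mono) simp
  ultimately have "(norm (C *v v))\<^sup>2 \<le> 0"
    by linarith
  then have "C *v v = 0"
    by simp
  then have "has_realization_of_dim G (CARD('n) - 1)"
    using bal v by (intro unobservable_reduction)
      (auto simp: balanced_realization_def minimal_realization_def)
  moreover have "\<not> has_realization_of_dim G (CARD('n) - 1)"
    using bal by (simp add: balanced_realization_def minimal_realization_def has_mcmillan_degree_def)
  ultimately show False by blast
qed

lemma balanced_realization_similar:
  assumes bal: "balanced_realization G A B C D" and S: "unitary S"
  shows "balanced_realization G (S ** A ** cadj S) (S ** B) (C ** cadj S) D"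
proof -
  let ?A = "S ** A ** cadj S"
  have SS: "S ** cadj S = mat 1" "cadj S ** S = mat 1"
    using S by (auto simp: unitary_def)
  have "finite {z. G z \<noteq> D + C ** cadj S ** matrix_inv (mat z - ?A) ** (S ** B)}"
  proof (rule finite_subset)
    show "finite ({z. \<not> invertible (mat z - A)} \<union> {z. G z \<noteq> D + C ** matrix_inv (mat z - A) ** B})"
      using bal by (simp add: finite_not_invertible realization_def eq_rational_def
          balanced_realization_def minimal_realization_def)
    have "C ** matrix_inv (mat z - A) ** B = C ** cadj S ** matrix_inv (mat z - ?A) ** (S ** B)"
      if "invertible (mat z - A)" for z
    proof -
      have "mat z - ?A = S ** (mat z - A) ** cadj S"
        by (simp add: matrix_distribs matrix_mul_assoc mat_commute)
          (simp add: SS flip: matrix_mul_assoc)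
      also have "\<dots> ** (S ** matrix_inv (mat z - A) ** cadj S)
          = S ** ((mat z - A) ** (cadj S ** S) ** matrix_inv (mat z - A)) ** cadj S"
        by (simp add: matrix_mul_assoc)
      also have "\<dots> = mat 1"
        by (simp add: SS matrix_inv_right that)
      finally have "matrix_inv (mat z - ?A) = S ** matrix_inv (mat z - A) ** cadj S"
        by (rule matrix_inv_eqI)
      then have "C ** cadj S ** matrix_inv (mat z - ?A) ** (S ** B)
          = C ** (cadj S ** S) ** matrix_inv (mat z - A) ** (cadj S ** S) ** B"
        by (simp add: matrix_mul_assoc)
      then show ?thesis
        by (simp add: SS)
    qed
    then show "{z. G z \<noteq> D + C ** cadj S ** matrix_inv (mat z - ?A) ** (S ** B)}
        \<subseteq> {z. \<not> invertible (mat z - A)} \<union> {z. G z \<noteq> D + C ** matrix_inv (mat z - A) ** B}"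
      by auto
  qed
  moreover have "realization_matrix ?A (S ** B) (C ** cadj S) D
      = block_mat (mat 1) 0 0 S ** realization_matrix A B C D ** block_mat (mat 1) 0 0 (cadj S)"
    by (simp add: realization_matrix_def block_mat_mult)
  moreover have "unitary (block_mat (mat 1) 0 0 S ** realization_matrix A B C D ** block_mat (mat 1) 0 0 (cadj S))"
    using bal S by (intro unitary_mult unitary_block_diag unitary_cadj unitary_one)
      (auto simp: balanced_realization_def)
  ultimately show ?thesis
    using bal by (simp add: balanced_realization_def minimal_realization_def realization_def eq_rational_def)
qed


section \<open>The matrices \<open>V\<close> and \<open>P\<close> of a balanced realization\<close>

lemma vcat_gram:
  fixes A :: "complex^('k::finite)^('r::finite)" and B :: "complex^'k^('s::finite)"
  shows "cadj (vcat A B) ** vcat A' B' = cadj A ** A' + cadj B ** B'"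
  by (simp add: vcat_def cadj_def vec_eq_iff matrix_matrix_mult_def sum_UNIV_Plus)

lemma balanced_stein:
  assumes onp: "output_normal_pair U W" and bal: "balanced_realization G A B C D"
  shows "vcat (chart_V U W G) (stein_sol A W (cadj C ** U))
    = cadj (realization_matrix A B C D) ** vcat U (stein_sol A W (cadj C ** U) ** W)"
proof -
  let ?Q = "stein_sol A W (cadj C ** U)"
  have st: "stable A" "stable W"
    using balanced_realization_stable [OF bal] onp by (auto simp: output_normal_pair_def)
  have Q: "?Q - cadj A ** ?Q ** W = cadj C ** U"
    by (rule stein_sol [OF st])
  have "chart_V U W G = cadj D ** U + cadj B ** ?Q ** W"
    using bal by (intro chart_V_eq [OF st _ Q])
      (auto simp: balanced_realization_def minimal_realization_def)
  moreover have "?Q = cadj C ** U + cadj A ** ?Q ** W"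
    using Q by (simp add: algebra_simps)
  ultimately show ?thesis
    by (simp add: realization_matrix_def cadj_block_mat block_mat_vcat matrix_mul_assoc)
qed

text \<open>The unitary realization matrix maps \<open>[V; Q]\<close> to \<open>[U; Q W]\<close>. Comparing Gram matrices gives
  the equation of \<open>P\<close> for \<open>Q\<^sup>* Q\<close>.\<close>

lemma chart_P_eq:
  assumes onp: "output_normal_pair U W" and bal: "balanced_realization G A B C D"
  defines "Q \<equiv> stein_sol A W (cadj C ** U)" and "V \<equiv> chart_V U W G"
  shows "chart_P U W V = cadj Q ** Q"
    and "cadj Q ** Q - cadj W ** (cadj Q ** Q) ** W = cadj U ** U - cadj V ** V"
proof -
  let ?R = "realization_matrix A B C D"
  have R: "?R ** cadj ?R = mat 1"
    using bal by (simp add: balanced_realization_def unitary_def)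
  have VQ: "vcat V Q = cadj ?R ** vcat U (Q ** W)"
    unfolding Q_def V_def by (rule balanced_stein [OF onp bal])
  have "cadj (vcat V Q) ** vcat V Q
      = cadj (vcat U (Q ** W)) ** (?R ** cadj ?R) ** vcat U (Q ** W)"
    unfolding VQ by (simp add: cadj_mult matrix_mul_assoc)
  then have "cadj V ** V + cadj Q ** Q = cadj U ** U + cadj W ** (cadj Q ** Q) ** W"
    by (simp add: R vcat_gram cadj_mult matrix_mul_assoc)
  then show *: "cadj Q ** Q - cadj W ** (cadj Q ** Q) ** W = cadj U ** U - cadj V ** V"
    by (simp add: algebra_simps)
  have "stable W"
    using onp by (simp add: output_normal_pair_def)
  then show "chart_P U W V = cadj Q ** Q"
    unfolding chart_P_def using * by (intro stein_sol_eqI)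
qed


section \<open>The unitary matrices of a chart\<close>

lemma inv_hsqrt_sandwich:
  assumes "pos_def K"
  shows "matrix_inv (hsqrt K) ** K ** matrix_inv (hsqrt K) = mat 1"
proof -
  have "matrix_inv (hsqrt K) ** K ** matrix_inv (hsqrt K)
      = (matrix_inv (hsqrt K) ** hsqrt K) ** (hsqrt K ** matrix_inv (hsqrt K))"
    by (subst (2) hsqrt_mult_self [OF assms, symmetric]) (simp add: matrix_mul_assoc)
  then show ?thesis
    using hsqrt_invertible [OF assms] by (simp add: matrix_inv_left matrix_inv_right)
qed

locale chart_point =
  fixes U :: "complex^('n::finite)^('p::finite)" and W :: "complex^'n^'n" and V :: "complex^'n^'p"
  assumes onp: "output_normal_pair U W"
    and P_pos: "pos_def (chart_P U W V)"
begin

abbreviation "P \<equiv> chart_P U W V"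

definition "T = hsqrt P"
definition "Ti = matrix_inv T"
definition "Ut = U ** Ti"
definition "Wt = T ** W ** Ti"
definition "Vt = V ** Ti"
definition "X = mat 1 - U ** matrix_inv (mat 1 - cadj W) ** cadj U"
definition "Y = (mat 1 - W) ** matrix_inv (mat 1 - cadj W) ** cadj U"
definition "K = cadj Ut ** Ut + cadj Wt ** Wt"

text \<open>\<open>K\<^sup>-\<^sup>1\<^sup>/\<^sup>2\<close>, which normalizes the second block columns of both \<open>\<U>\<close> and \<open>\<V>\<close>, since
  \<open>K = I + V\<^sub>t\<^sup>* V\<^sub>t\<close>.\<close>

definition "Fk = matrix_inv (hsqrt K)"

definition "Z = cadj X ** X + cadj Y ** matrix_inv P ** Y"

lemma stable_W: "stable W" and isometry_UW: "cadj U ** U + cadj W ** W = mat 1"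
  using onp by (auto simp: output_normal_pair_def)

lemma P_stein: "P - cadj W ** P ** W = cadj U ** U - cadj V ** V"
  unfolding chart_P_def by (rule stein_sol [OF stable_W stable_W])

lemma T_props:
  shows T_T: "T ** T = P" and cadj_T: "cadj T = T"
    and T_Ti: "T ** Ti = mat 1" and Ti_T: "Ti ** T = mat 1" and cadj_Ti: "cadj Ti = Ti"
  using P_pos by (simp_all add: T_def Ti_def pos_def_hsqrt hsqrt_mult_self cadj_hsqrt
      hsqrt_invertible matrix_inv_left matrix_inv_right cadj_inv_hsqrt)

lemma T_Ti_assoc: "M ** T ** Ti = M" and Ti_T_assoc: "M ** Ti ** T = M"
  by (simp_all add: T_Ti Ti_T flip: matrix_mul_assoc)

lemma P_inv: "matrix_inv P = Ti ** Ti"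
  by (rule matrix_inv_eqI) (simp add: matrix_mul_assoc T_Ti_assoc T_Ti flip: T_T)

lemma K_eq: "K = mat 1 + cadj Vt ** Vt"
proof -
  have "K = Ti ** (cadj U ** U + cadj W ** P ** W) ** Ti"
    by (simp add: K_def Ut_def Wt_def cadj_mult cadj_T cadj_Ti matrix_distribs matrix_mul_assoc
        flip: T_T)
  also have "cadj U ** U + cadj W ** P ** W = T ** T + cadj V ** V"
    using P_stein by (simp add: T_T algebra_simps)
  also have "Ti ** (T ** T + cadj V ** V) ** Ti = mat 1 + cadj Vt ** Vt"
    by (simp add: Vt_def cadj_mult cadj_Ti matrix_distribs matrix_mul_assoc T_Ti_assoc Ti_T T_Ti)
  finally show ?thesis .
qed

lemma K_pos: "pos_def K"
  using pos_def_gram_sum [of "mat 1" Vt] by (simp add: K_eq)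

lemma Fk_props: "cadj Fk = Fk" "Fk ** K ** Fk = mat 1" "invertible Fk"
  using K_pos by (simp_all add: Fk_def cadj_inv_hsqrt inv_hsqrt_sandwich
      hsqrt_invertible invertible_matrix_inv)

lemma calV_eq:
  obtains E where "chart_calV U W V = block_mat E (Vt ** Fk) (- (cadj Vt ** E)) Fk"
    "cadj E = E" "E ** (mat 1 + Vt ** cadj Vt) ** E = mat 1"
proof
  let ?E = "matrix_inv (hsqrt (mat 1 + Vt ** cadj Vt))"
  have pos: "pos_def (mat 1 + Vt ** cadj Vt)"
    using pos_def_gram_sum [of "mat 1" "cadj Vt"] by simp
  show "chart_calV U W V = block_mat ?E (Vt ** Fk) (- (cadj Vt ** ?E)) Fk"
    by (simp add: chart_calV_def Let_def Fk_def K_eq Vt_def Ti_def T_def)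
  show "cadj ?E = ?E" "?E ** (mat 1 + Vt ** cadj Vt) ** ?E = mat 1"
    using pos by (simp_all add: cadj_inv_hsqrt inv_hsqrt_sandwich)
qed

lemma unitary_calV: "unitary (chart_calV U W V)"
proof (rule calV_eq)
  fix E assume V: "chart_calV U W V = block_mat E (Vt ** Fk) (- (cadj Vt ** E)) Fk"
    and E: "cadj E = E" "E ** (mat 1 + Vt ** cadj Vt) ** E = mat 1"
  have E2: "E ** E + E ** Vt ** cadj Vt ** E = mat 1"
    using E(2) by (simp add: matrix_distribs matrix_mul_assoc)
  have F2: "Fk ** cadj Vt ** Vt ** Fk + Fk ** Fk = mat 1"
    using Fk_props(2) by (simp add: K_eq matrix_distribs matrix_mul_assoc add.commute)
  show "unitary (chart_calV U W V)"
    by (rule unitaryI)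
      (simp add: V cadj_block_mat block_mat_mult mat_block cadj_mult cadj_uminus E(1) Fk_props(1)
        matrix_uminus_left matrix_uminus_right matrix_mul_assoc E2 F2)
qed

text \<open>\<open>(X, U; Y, W)\<close> completes the isometry \<open>[U; W]\<close> to a unitary matrix.\<close>

lemma completion:
  shows XY_orth: "cadj U ** X + cadj W ** Y = 0" and XY_isometry: "cadj X ** X + cadj Y ** Y = mat 1"
proof -
  define M where "M = matrix_inv (mat 1 - cadj W)"
  have inv: "invertible (mat 1 - cadj W)"
    using stable_cadj_invertible_inside [OF stable_W, of 1] by simp
  have M: "(mat 1 - cadj W) ** M = mat 1" "M ** (mat 1 - cadj W) = mat 1"
    using inv by (simp_all add: M_def matrix_inv_left matrix_inv_right)
  have "cadj ((mat 1 - cadj W) ** M) = mat 1"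
    by (simp add: M(1))
  then have M': "cadj M ** (mat 1 - W) = mat 1"
    by (simp add: cadj_simps)
  have UU: "cadj U ** U = mat 1 - cadj W ** W"
    using isometry_UW by (simp add: algebra_simps)
  have X: "X = mat 1 - U ** M ** cadj U" and Y: "Y = (mat 1 - W) ** M ** cadj U"
    by (simp_all add: X_def Y_def M_def)
  have "cadj U ** X + cadj W ** Y
      = cadj U - (cadj U ** U) ** M ** cadj U + cadj W ** (mat 1 - W) ** M ** cadj U"
    by (simp add: X Y matrix_distribs matrix_mul_assoc)
  also have "\<dots> = cadj U - ((mat 1 - cadj W) ** M) ** cadj U"
    unfolding UU by (simp add: matrix_distribs matrix_mul_assoc)
  finally show "cadj U ** X + cadj W ** Y = 0"
    by (simp add: M(1))
  have "cadj X ** X = mat 1 - U ** M ** cadj U - U ** cadj M ** cadj U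
      + U ** cadj M ** (cadj U ** U) ** M ** cadj U"
    by (simp add: X cadj_simps matrix_distribs matrix_mul_assoc)
  moreover have "cadj Y ** Y = U ** cadj M ** ((mat 1 - cadj W) ** (mat 1 - W)) ** M ** cadj U"
    by (simp add: Y cadj_simps matrix_mul_assoc)
  ultimately have "cadj X ** X + cadj Y ** Y = mat 1 - U ** M ** cadj U - U ** cadj M ** cadj U
      + U ** cadj M ** (cadj U ** U + (mat 1 - cadj W) ** (mat 1 - W)) ** M ** cadj U"
    by (simp add: matrix_add_ldistrib matrix_add_rdistrib)
  also have "cadj U ** U + (mat 1 - cadj W) ** (mat 1 - W) = (mat 1 - cadj W) + (mat 1 - W)"
    unfolding UU by (simp add: matrix_distribs)
  also have "U ** cadj M ** ((mat 1 - cadj W) + (mat 1 - W)) ** M ** cadj U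
      = U ** cadj M ** ((mat 1 - cadj W) ** M) ** cadj U + U ** (cadj M ** (mat 1 - W)) ** M ** cadj U"
    by (simp only: matrix_add_ldistrib matrix_add_rdistrib matrix_mul_assoc)
  finally show "cadj X ** X + cadj Y ** Y = mat 1"
    by (simp add: M(1) M')
qed

lemma Z_eq: "Z = cadj X ** X + cadj (Ti ** Y) ** (Ti ** Y)"
  by (simp add: Z_def P_inv cadj_mult cadj_Ti matrix_mul_assoc)

lemma Z_pos: "pos_def Z"
  unfolding Z_eq
proof (rule pos_def_gram_sum)
  fix x assume Xx: "X *v x = 0" and "(Ti ** Y) *v x = 0"
  then have "(T ** (Ti ** Y)) *v x = 0"
    by (simp flip: matrix_vector_mul_assoc)
  then have "Y *v x = 0"
    by (simp add: matrix_mul_assoc T_Ti)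
  then have "(cadj X ** X + cadj Y ** Y) *v x = 0"
    using Xx by (simp add: matrix_vector_mult_add_rdistrib flip: matrix_vector_mul_assoc)
  then show "x = 0"
    by (simp add: XY_isometry)
qed

lemma orth: "cadj X ** Ut + cadj (Ti ** Y) ** Wt = 0"
proof -
  have "cadj X ** Ut + cadj (Ti ** Y) ** Wt = cadj (cadj U ** X + cadj W ** Y) ** Ti"
    by (simp add: Ut_def Wt_def cadj_mult cadj_add cadj_Ti matrix_distribs matrix_mul_assoc Ti_T_assoc)
  then show ?thesis
    by (simp add: XY_orth)
qed

text \<open>The columns of \<open>[X; T\<^sup>-\<^sup>1 Y]\<close> span the orthogonal complement of those of \<open>[U T\<^sup>-\<^sup>1; T W T\<^sup>-\<^sup>1]\<close>, and their
  Gram matrix is \<open>Z\<close>. The triangular factor in the definition of \<open>\<U>\<close> projects \<open>[X; T Y]\<close>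
  to this complement; by \<open>X\<^sup>* X + Y\<^sup>* Y = I\<close> the projection is \<open>[X; T\<^sup>-\<^sup>1 Y] Z\<^sup>-\<^sup>1\<close>, and the factor \<open>Z\<^sup>1\<^sup>/\<^sup>2\<close>
  normalizes it.\<close>

lemma calU_eq:
  obtains N where "chart_calU U W V = block_mat (X ** N) (Ut ** Fk) (Ti ** Y ** N) (Wt ** Fk)"
    "cadj N ** Z ** N = mat 1"
proof
  define Zi where "Zi = matrix_inv Z"
  define Ki where "Ki = matrix_inv K"
  let ?L = "cadj Ut ** X + cadj Wt ** T ** Y"
  let ?N = "block_mat X Ut (Ti ** Y) Wt"
  have inv: "Z ** Zi = mat 1" "Zi ** Z = mat 1" "Ki ** K = mat 1"
    using Z_pos K_pos by (simp_all add: Zi_def Ki_def pos_def_invertible matrix_inv_left matrix_inv_right)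
  have orth': "cadj Ut ** X + cadj Wt ** (Ti ** Y) = 0"
    using arg_cong [OF orth, of cadj] by (simp add: cadj_simps)
  have gram: "cadj ?N ** ?N = block_mat Z 0 0 K"
    by (simp add: cadj_block_mat block_mat_mult orth orth' flip: Z_eq K_def)
  have "block_mat Zi 0 0 Ki ** cadj ?N ** ?N = block_mat Zi 0 0 Ki ** block_mat Z 0 0 K"
    by (simp only: gram flip: matrix_mul_assoc)
  then have "block_mat Zi 0 0 Ki ** cadj ?N ** ?N = mat 1"
    by (simp add: block_mat_mult mat_block inv)
  then have "?N ** (block_mat Zi 0 0 Ki ** cadj ?N) = mat 1"
    by (simp add: matrix_left_right_inverse)
  then have proj: "X ** Zi ** cadj X + Ut ** Ki ** cadj Ut = mat 1"
    "X ** Zi ** cadj (Ti ** Y) + Ut ** Ki ** cadj Wt = 0"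
    "Ti ** Y ** Zi ** cadj X + Wt ** Ki ** cadj Ut = 0"
    "Ti ** Y ** Zi ** cadj (Ti ** Y) + Wt ** Ki ** cadj Wt = mat 1"
    by (simp_all add: cadj_block_mat block_mat_mult mat_block matrix_mul_assoc)
  have XY: "cadj X ** X + cadj (Ti ** Y) ** T ** Y = mat 1"
    using XY_isometry by (simp add: cadj_mult cadj_Ti matrix_mul_assoc Ti_T_assoc)
  have "X - Ut ** Ki ** ?L
      = X - (Ut ** Ki ** cadj Ut) ** X - (Ut ** Ki ** cadj Wt) ** T ** Y"
    by (simp add: matrix_distribs matrix_mul_assoc)
  also have "Ut ** Ki ** cadj Ut = mat 1 - X ** Zi ** cadj X"
    using proj(1) by (simp add: algebra_simps)
  also have "Ut ** Ki ** cadj Wt = - (X ** Zi ** cadj (Ti ** Y))"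
    using proj(2) by (simp add: eq_neg_iff_add_eq_0 add.commute)
  also have "X - (mat 1 - X ** Zi ** cadj X) ** X - - (X ** Zi ** cadj (Ti ** Y)) ** T ** Y
      = X ** Zi ** (cadj X ** X + cadj (Ti ** Y) ** T ** Y)"
    by (simp add: matrix_distribs matrix_mul_assoc)
  finally have col1: "X - Ut ** Ki ** ?L = X ** Zi"
    by (simp add: XY)
  have "T ** Y - Wt ** Ki ** ?L
      = T ** Y - (Wt ** Ki ** cadj Ut) ** X - (Wt ** Ki ** cadj Wt) ** T ** Y"
    by (simp add: matrix_distribs matrix_mul_assoc)
  also have "Wt ** Ki ** cadj Ut = - (Ti ** Y ** Zi ** cadj X)"
    using proj(3) by (simp add: eq_neg_iff_add_eq_0 add.commute)
  also have "Wt ** Ki ** cadj Wt = mat 1 - Ti ** Y ** Zi ** cadj (Ti ** Y)"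
    using proj(4) by (simp add: algebra_simps)
  also have "T ** Y - - (Ti ** Y ** Zi ** cadj X) ** X - (mat 1 - Ti ** Y ** Zi ** cadj (Ti ** Y)) ** T ** Y
      = Ti ** Y ** Zi ** (cadj X ** X + cadj (Ti ** Y) ** T ** Y)"
    by (simp add: matrix_distribs matrix_mul_assoc)
  finally have col2: "T ** Y - Wt ** Ki ** ?L = Ti ** Y ** Zi"
    by (simp add: XY)
  have "chart_calU U W V = block_mat X Ut (T ** Y) Wt **
      block_mat (hsqrt Z) 0 (- (Ki ** ?L ** hsqrt Z)) Fk"
    by (simp add: chart_calU_def Let_def Ut_def Wt_def X_def Y_def K_def Z_def Fk_def Ki_def
        Ti_def T_def)
  also have "\<dots> = block_mat ((X - Ut ** Ki ** ?L) ** hsqrt Z) (Ut ** Fk)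
      ((T ** Y - Wt ** Ki ** ?L) ** hsqrt Z) (Wt ** Fk)"
    by (simp add: block_mat_mult matrix_diff_rdistrib matrix_uminus_right matrix_mul_assoc)
  also have "\<dots> = block_mat (X ** (Zi ** hsqrt Z)) (Ut ** Fk) (Ti ** Y ** (Zi ** hsqrt Z)) (Wt ** Fk)"
    unfolding col1 col2 by (simp add: matrix_mul_assoc)
  also have "Zi ** hsqrt Z = matrix_inv (hsqrt Z)"
  proof (rule matrix_inv_eqI [symmetric])
    have "Zi ** hsqrt Z ** hsqrt Z = Zi ** Z"
      using Z_pos by (simp add: hsqrt_mult_self flip: matrix_mul_assoc)
    then show "hsqrt Z ** (Zi ** hsqrt Z) = mat 1"
      by (simp add: inv matrix_left_right_inverse)
  qed
  finally show "chart_calU U W V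
      = block_mat (X ** matrix_inv (hsqrt Z)) (Ut ** Fk) (Ti ** Y ** matrix_inv (hsqrt Z)) (Wt ** Fk)" .
  show "cadj (matrix_inv (hsqrt Z)) ** Z ** matrix_inv (hsqrt Z) = mat 1"
    using Z_pos by (simp add: cadj_inv_hsqrt inv_hsqrt_sandwich)
qed

lemma unitary_calU: "unitary (chart_calU U W V)"
proof (rule calU_eq)
  fix N assume U: "chart_calU U W V = block_mat (X ** N) (Ut ** Fk) (Ti ** Y ** N) (Wt ** Fk)"
    and N: "cadj N ** Z ** N = mat 1"
  have orth': "cadj Ut ** X + cadj Wt ** (Ti ** Y) = 0"
    using arg_cong [OF orth, of cadj] by (simp add: cadj_simps)
  have "cadj N ** (cadj X ** X + cadj (Ti ** Y) ** (Ti ** Y)) ** N = mat 1"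
    "cadj N ** (cadj X ** Ut + cadj (Ti ** Y) ** Wt) ** Fk = 0"
    "Fk ** (cadj Ut ** X + cadj Wt ** (Ti ** Y)) ** N = 0"
    "Fk ** (cadj Ut ** Ut + cadj Wt ** Wt) ** Fk = mat 1"
    using N Fk_props(2) by (simp_all only: orth orth' Z_eq K_def matrix_zero_left matrix_zero_right)
  then show "unitary (chart_calU U W V)"
    by (intro unitaryI)
      (simp add: U cadj_block_mat block_mat_mult mat_block cadj_mult Fk_props(1)
        matrix_distribs matrix_mul_assoc)
qed

lemma calU_col: "block12 (chart_calU U W V) = Ut ** Fk" "block22 (chart_calU U W V) = Wt ** Fk"
  by (rule calU_eq, simp)+

lemma calV_col: "block12 (chart_calV U W V) = Vt ** Fk" "block22 (chart_calV U W V) = Fk"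
  by (rule calV_eq, simp)+

lemma invertible_pencil:
  assumes "invertible (mat z - W)"
  shows "invertible (block22 (chart_calV U W V) ** mat z - block22 (chart_calU U W V))"
proof -
  have "block22 (chart_calV U W V) ** mat z - block22 (chart_calU U W V) = T ** (mat z - W) ** Ti ** Fk"
    by (simp add: calU_col calV_col Wt_def matrix_distribs matrix_mul_assoc mat_commute)
      (simp add: T_Ti flip: matrix_mul_assoc)
  moreover have "invertible T" "invertible Ti"
    using invertibleI [OF T_Ti] invertibleI [OF Ti_T] by auto
  ultimately show ?thesis
    using assms by (simp add: invertible_mult Fk_props(3))
qed

lemma invertible_dual_pencil:
  assumes "cmod z \<le> 1"
  shows "invertible (cadj (block22 (chart_calV U W V)) - mat z ** cadj (block22 (chart_calU U W V)))"
proof -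
  have "cadj (block22 (chart_calV U W V)) - mat z ** cadj (block22 (chart_calU U W V))
      = Fk ** Ti ** (mat 1 - mat z ** cadj W) ** T"
    by (simp add: calU_col calV_col Wt_def cadj_mult cadj_T cadj_Ti Fk_props(1)
        matrix_distribs matrix_mul_assoc mat_commute Ti_T_assoc)
  moreover have "invertible T" "invertible Ti"
    using invertibleI [OF T_Ti] invertibleI [OF Ti_T] by auto
  ultimately show ?thesis
    using stable_cadj_invertible_inside [OF stable_W assms] by (simp add: invertible_mult Fk_props(3))
qed

text \<open>The second block columns of \<open>\<U>\<close> and \<open>\<V>\<close> are \<open>[U; T W]\<close> and \<open>[V; T]\<close> up to one common invertible
  factor. For a unitary \<open>R\<close> and \<open>M = R\<^sup>*\<close>, the left side says that \<open>\<U>\<^sup>* R \<V>\<close> fixes the second block of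
  coordinates, that is, \<open>R = \<U> diag(F, I) \<V>\<^sup>*\<close> for some \<open>F\<close>.\<close>

lemma calU_calV_transfer:
  "M ** (chart_calU U W V ** vcat 0 (mat 1)) = chart_calV U W V ** vcat 0 (mat 1)
    \<longleftrightarrow> M ** vcat U (T ** W) = vcat V T"
proof -
  have u: "chart_calU U W V ** vcat 0 (mat 1) = vcat U (T ** W) ** (Ti ** Fk)"
    by (subst block_mat_blocks [symmetric], subst block_mat_vcat)
      (simp add: calU_col Ut_def Wt_def vcat_mult matrix_mul_assoc)
  have v: "chart_calV U W V ** vcat 0 (mat 1) = vcat V T ** (Ti ** Fk)"
    by (subst block_mat_blocks [symmetric], subst block_mat_vcat)
      (simp add: calV_col Vt_def vcat_mult matrix_mul_assoc T_Ti)
  have inv: "invertible (Ti ** Fk)"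
    by (rule invertible_mult [OF invertibleI [OF Ti_T] Fk_props(3)])
  have cancel: "N ** (Ti ** Fk) = N' ** (Ti ** Fk) \<longleftrightarrow> N = N'" for N N' :: "complex^'n^('p + 'n)"
  proof
    assume "N ** (Ti ** Fk) = N' ** (Ti ** Fk)"
    then have "N ** (Ti ** Fk) ** matrix_inv (Ti ** Fk) = N' ** (Ti ** Fk) ** matrix_inv (Ti ** Fk)"
      by (rule arg_cong)
    then show "N = N'"
      by (simp only: matrix_inv_right_assoc [OF inv])
  qed simp
  show ?thesis
    unfolding u v matrix_mul_assoc [of M] by (rule cancel)
qed

end


section \<open>The linear fractional parametrization\<close>

lemma vcat_diff: "vcat A B - vcat A' B' = vcat (A - A') (B - (B' :: complex^('k::finite)^('s::finite)))"
  for A A' :: "complex^'k^('r::finite)"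
  by (simp add: vcat_def vec_eq_iff split: sum.splits)

lemma cadj_blocks:
  fixes M :: "complex^('c::finite + 'd::finite)^('r::finite + 's::finite)"
  shows "block12 (cadj M) = cadj (block21 M)" "block22 (cadj M) = cadj (block22 M)"
  by (simp_all add: block_defs cadj_def vec_eq_iff)

lemma block_vcat_zero:
  fixes M :: "complex^('c::finite + 'd::finite)^('r::finite + 's::finite)"
  shows "M ** vcat 0 N = vcat (block12 M ** N) (block22 M ** N)"
  by (subst block_mat_blocks [symmetric], subst block_mat_vcat) simp

lemma infinite_unit_circle: "infinite {z. cmod z = 1}"
proof -
  have "inj_on cis {0..pi}"
    by (rule inj_onI) (metis cis.sel(1) atLeastAtMost_iff cos_inj_pi)
  then have "infinite (cis ` {0..pi})"
    using finite_imageD pi_gt_zero infinite_Icc by blast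
  then show ?thesis
    by (rule infinite_super [rotated]) auto
qed

context chart_point
begin

abbreviation "CU \<equiv> chart_calU U W V"
abbreviation "CV \<equiv> chart_calV U W V"

text \<open>Let \<open>R = \<U> diag(F, I) \<V>\<^sup>*\<close>, and let \<open>[y; z x] = R [u; x]\<close> be the equations at frequency \<open>z\<close> of the
  system with realization matrix \<open>R\<close>. In the coordinates \<open>[a; \<xi>] = \<V>\<^sup>* [u; x]\<close> they read
  \<open>[u; x] = \<V> [a; \<xi>]\<close> and \<open>[y; z x] = \<U> [F a; \<xi>]\<close>. Eliminating \<open>\<xi>\<close> expresses \<open>u\<close> and \<open>y\<close> by \<open>a\<close>, and the
  coefficients are the denominator and the numerator of the linear fractional transformation.
  The state \<open>x\<close> is a function of \<open>u\<close>, and so is \<open>a\<close>; therefore the denominator is invertible.\<close>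

lemma lft_chart_Theta:
  assumes R: "realization_matrix A B C D = CU ** block_mat F 0 0 (mat 1) ** cadj CV"
    and invA: "invertible (mat z - A)" and invW: "invertible (mat z - W)"
  obtains \<xi> x u y where
    "CV ** vcat (mat 1) \<xi> = vcat u x" "CU ** vcat F \<xi> = vcat y (mat z ** x)"
    "invertible u" "y = (D + C ** matrix_inv (mat z - A) ** B) ** u"
    "lft (chart_Theta W U V z) F = D + C ** matrix_inv (mat z - A) ** B"
proof -
  let ?N = "block22 CV ** mat z - block22 CU"
  define \<xi> where "\<xi> = matrix_inv ?N ** (block21 CU ** F - mat z ** block21 CV)"
  define u where "u = block11 CV + block12 CV ** \<xi>"
  define x where "x = block21 CV + block22 CV ** \<xi>"
  define y where "y = block11 CU ** F + block12 CU ** \<xi>"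
  have v: "CV ** vcat (mat 1) \<xi> = vcat u x"
    by (subst block_mat_blocks [symmetric], subst block_mat_vcat) (simp add: u_def x_def)
  have "?N ** \<xi> = block21 CU ** F - mat z ** block21 CV"
    using invertible_pencil [OF invW] by (simp add: \<xi>_def matrix_mul_assoc matrix_inv_right)
  then have "mat z ** x = block21 CU ** F + block22 CU ** \<xi>"
    by (simp add: x_def matrix_distribs mat_commute matrix_mul_assoc algebra_simps)
  then have w: "CU ** vcat F \<xi> = vcat y (mat z ** x)"
    by (subst block_mat_blocks [symmetric], subst block_mat_vcat) (simp add: y_def)
  have VV: "cadj CV ** CV = mat 1"
    using unitary_calV by (simp add: unitary_def)
  have "realization_matrix A B C D ** vcat u x = CU ** (block_mat F 0 0 (mat 1) ** vcat (mat 1) \<xi>)"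
    by (simp add: R VV matrix_inv_left flip: v matrix_mul_assoc)
      (simp add: VV matrix_mul_assoc)
  then have "vcat (D ** u + C ** x) (B ** u + A ** x) = vcat y (mat z ** x)"
    by (simp add: realization_matrix_def block_mat_vcat w)
  then have y: "y = D ** u + C ** x" and "(mat z - A) ** x = B ** u"
    by (simp_all add: matrix_diff_rdistrib algebra_simps)
  then have x: "x = matrix_inv (mat z - A) ** B ** u"
    using invA by (metis matrix_inv_left matrix_mul_assoc matrix_mul_lid)
  have "vcat (mat 1) \<xi> = cadj CV ** vcat u x"
    by (simp add: VV matrix_mul_assoc flip: v)
  also have "\<dots> = vcat (block11 (cadj CV) ** u + block12 (cadj CV) ** x)
      (block21 (cadj CV) ** u + block22 (cadj CV) ** x)"
    by (subst block_mat_blocks [symmetric], subst block_mat_vcat) simp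
  finally have "mat 1 = block11 (cadj CV) ** u + block12 (cadj CV) ** (matrix_inv (mat z - A) ** B ** u)"
    by (simp only: vcat_inject flip: x)
  then have "mat 1 = (block11 (cadj CV) + block12 (cadj CV) ** matrix_inv (mat z - A) ** B) ** u"
    by (simp add: matrix_add_rdistrib matrix_mul_assoc)
  then have inv_u: "invertible u"
    by (metis invertible_left_inverse)
  have y': "y = (D + C ** matrix_inv (mat z - A) ** B) ** u"
    by (simp add: y x matrix_add_rdistrib matrix_mul_assoc)
  have "hcat (block21 CU) (block21 CV) ** block_mat (mat 1) 0 0 (- mat 1) ** block_mat (mat 1) 0 0 (mat z)
      = hcat (block21 CU) (- (mat z ** block21 CV))"
    by (simp add: hcat_block_mat matrix_uminus_left matrix_uminus_right mat_commute)
  then have "chart_Theta W U V z = block_mat (block11 CU) 0 0 (block11 CV) +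
      vcat (block12 CU) (block12 CV) ** matrix_inv ?N ** hcat (block21 CU) (- (mat z ** block21 CV))"
    by (simp add: chart_Theta_def Let_def flip: matrix_mul_assoc)
  then have "block11 (chart_Theta W U V z) ** F + block12 (chart_Theta W U V z) = y"
    and "block21 (chart_Theta W U V z) ** F + block22 (chart_Theta W U V z) = u"
    unfolding vcat_mult_hcat block_mat_add
    by (simp_all add: y_def u_def \<xi>_def matrix_distribs matrix_mul_assoc)
  then have "lft (chart_Theta W U V z) F = y ** matrix_inv u"
    by (simp add: lft_def)
  then have "lft (chart_Theta W U V z) F = D + C ** matrix_inv (mat z - A) ** B"
    using inv_u by (simp add: y' matrix_inv_right_assoc)
  with v w inv_u y' that show thesis
    by blast
qed

text \<open>If \<open>F\<close> and \<open>F'\<close> give the same value at a point \<open>z\<close> of the circle, normalize the solutions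
  for \<open>F'\<close> to the input \<open>u\<close> of those for \<open>F\<close>. The outputs agree as well, so the difference solves
  \<open>\<V> [a; \<xi>] = [0; x]\<close> and \<open>\<U> [b; \<xi>] = [0; z x]\<close>. Reading off \<open>\<xi>\<close> in both equations
  leaves \<open>x\<close> in the kernel of the invertible matrix \<open>K\<^sub>v\<^sup>* - z K\<^sub>u\<^sup>*\<close>.\<close>

lemma lft_chart_Theta_inj:
  assumes R: "realization_matrix A B C D = CU ** block_mat F 0 0 (mat 1) ** cadj CV"
    and R': "realization_matrix A' B' C' D' = CU ** block_mat F' 0 0 (mat 1) ** cadj CV"
    and inv: "invertible (mat z - A)" "invertible (mat z - A')" and z: "cmod z = 1"
    and eq: "lft (chart_Theta W U V z) F = lft (chart_Theta W U V z) F'"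
  shows "F = F'"
proof -
  have invW: "invertible (mat z - W)"
    using stable_W z by (simp add: stable_invertible_outside)
  obtain \<xi> x u y where 1: "CV ** vcat (mat 1) \<xi> = vcat u x" "CU ** vcat F \<xi> = vcat y (mat z ** x)"
    "invertible u" "y = lft (chart_Theta W U V z) F ** u"
    by (rule lft_chart_Theta [OF R inv(1) invW]) metis
  obtain \<xi>' x' u' y' where 2: "CV ** vcat (mat 1) \<xi>' = vcat u' x'" "CU ** vcat F' \<xi>' = vcat y' (mat z ** x')"
    "invertible u'" "y' = lft (chart_Theta W U V z) F' ** u'"
    by (rule lft_chart_Theta [OF R' inv(2) invW]) metis
  define E where "E = matrix_inv u' ** u"
  have u: "u = u' ** E"
    using 2(3) by (simp add: E_def matrix_mul_assoc matrix_inv_right)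
  have "y = lft (chart_Theta W U V z) F' ** u"
    using 1(4) eq by simp
  also have "\<dots> = lft (chart_Theta W U V z) F' ** (u' ** E)"
    by (rule arg_cong [OF u])
  finally have y: "y = y' ** E"
    by (simp add: 2(4) matrix_mul_assoc)
  define dx where "dx = x - x' ** E"
  define d\<xi> where "d\<xi> = \<xi> - \<xi>' ** E"
  have "CV ** vcat (mat 1 - E) d\<xi> = CV ** vcat (mat 1) \<xi> - CV ** vcat (mat 1) \<xi>' ** E"
    by (simp add: d\<xi>_def vcat_mult matrix_diff_ldistrib flip: vcat_diff matrix_mul_assoc)
  also have "\<dots> = vcat 0 dx"
    by (simp add: 1(1) 2(1) u vcat_mult vcat_diff dx_def)
  finally have "cadj CV ** (CV ** vcat (mat 1 - E) d\<xi>) = cadj CV ** vcat 0 dx"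
    by simp
  then have "vcat (mat 1 - E) d\<xi> = cadj CV ** vcat 0 dx"
    using unitary_calV by (simp add: unitary_def matrix_mul_assoc)
  then have V: "mat 1 - E = cadj (block21 CV) ** dx" "d\<xi> = cadj (block22 CV) ** dx"
    by (simp_all add: block_vcat_zero cadj_blocks)
  have "CU ** vcat (F - F' ** E) d\<xi> = CU ** vcat F \<xi> - CU ** vcat F' \<xi>' ** E"
    by (simp add: d\<xi>_def vcat_mult matrix_diff_ldistrib flip: vcat_diff matrix_mul_assoc)
  also have "\<dots> = vcat 0 (mat z ** dx)"
    by (simp add: 1(2) 2(2) y vcat_mult vcat_diff dx_def matrix_diff_ldistrib matrix_mul_assoc)
  finally have "cadj CU ** (CU ** vcat (F - F' ** E) d\<xi>) = cadj CU ** vcat 0 (mat z ** dx)"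
    by simp
  then have "vcat (F - F' ** E) d\<xi> = cadj CU ** vcat 0 (mat z ** dx)"
    using unitary_calU by (simp add: unitary_def matrix_mul_assoc)
  then have U: "F - F' ** E = cadj (block21 CU) ** (mat z ** dx)"
    "d\<xi> = cadj (block22 CU) ** (mat z ** dx)"
    by (simp_all add: block_vcat_zero cadj_blocks)
  let ?M = "cadj (block22 CV) - mat z ** cadj (block22 CU)"
  have "?M ** dx = 0"
    using V(2) U(2) by (simp add: matrix_diff_rdistrib matrix_mul_assoc mat_commute)
  moreover have "invertible ?M"
    using z by (intro invertible_dual_pencil) simp
  ultimately have "dx = 0"
    by (metis matrix_inv_left matrix_mul_assoc matrix_mul_lid matrix_zero_right)
  then have "E = mat 1" "F = F' ** E"
    using V(1) U(1) by simp_all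
  then show ?thesis
    by simp
qed

lemma chart_G0_eq:
  assumes G: "realization G A B C D" and V: "V = chart_V U W G" and F: "unitary F"
    and R: "realization_matrix A B C D = CU ** block_mat F 0 0 (mat 1) ** cadj CV"
  shows "chart_G0 U W G = F"
  unfolding chart_G0_def V [symmetric]
proof (rule the_equality)
  have "finite ({z. \<not> invertible (mat z - A)} \<union> {z. \<not> invertible (mat z - W)}
      \<union> {z. G z \<noteq> D + C ** matrix_inv (mat z - A) ** B})"
    using G by (simp add: finite_not_invertible realization_def eq_rational_def)
  moreover have "{z. G z \<noteq> lft (chart_Theta W U V z) F} \<subseteq>
      {z. \<not> invertible (mat z - A)} \<union> {z. \<not> invertible (mat z - W)}
      \<union> {z. G z \<noteq> D + C ** matrix_inv (mat z - A) ** B}"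
    using lft_chart_Theta [OF R] by fastforce
  ultimately have FG: "eq_rational G (\<lambda>z. lft (chart_Theta W U V z) F)"
    unfolding eq_rational_def by (rule finite_subset [rotated])
  then show "unitary F \<and> eq_rational G (\<lambda>z. lft (chart_Theta W U V z) F)"
    using F by simp
  fix F' assume F': "unitary F' \<and> eq_rational G (\<lambda>z. lft (chart_Theta W U V z) F')"
  let ?R' = "CU ** block_mat F' 0 0 (mat 1) ** cadj CV"
  obtain A' B' C' D' where R': "realization_matrix A' B' C' D' = ?R'"
    by (rule that [of "block22 ?R'" "block21 ?R'" "block12 ?R'" "block11 ?R'"])
      (simp add: realization_matrix_def)
  define bad where "bad = {z. \<not> invertible (mat z - A)} \<union> {z. \<not> invertible (mat z - A')}
      \<union> {z. G z \<noteq> lft (chart_Theta W U V z) F} \<union> {z. G z \<noteq> lft (chart_Theta W U V z) F'}"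
  have "finite bad"
    using FG F' by (simp add: bad_def finite_not_invertible eq_rational_def)
  then have "\<not> {z. cmod z = 1} \<subseteq> bad"
    using infinite_unit_circle finite_subset by blast
  then obtain z where "cmod z = 1" "z \<notin> bad"
    by blast
  then have "F = F'"
    by (intro lft_chart_Theta_inj [OF R R', of z]) (auto simp: bad_def)
  then show "F' = F"
    by simp
qed

end

section \<open>Positivity of the Stein solution and canonical forms\<close>

lemma in_chart_iff_stein_invertible:
  assumes "output_normal_pair U W" "balanced_realization G A B C D"
  shows "in_chart U W G \<longleftrightarrow> invertible (stein_sol A W (cadj C ** U))"
  by (simp add: in_chart_def chart_P_eq [OF assms] pos_def_gram_iff)

lemma stein_sol_similar:
  fixes A W S :: "complex^'n^'n"
  assumes S: "unitary S" and "stable A" "stable W" "stable (S ** A ** cadj S)"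
  shows "stein_sol (S ** A ** cadj S) W (cadj (C ** cadj S) ** U) = S ** stein_sol A W (cadj C ** U)"
proof (rule stein_sol_eqI)
  let ?Q = "stein_sol A W (cadj C ** U)"
  have "S ** ?Q - cadj (S ** A ** cadj S) ** (S ** ?Q) ** W
      = S ** ?Q - S ** cadj A ** (cadj S ** S) ** ?Q ** W"
    by (simp add: cadj_mult matrix_mul_assoc)
  also have "\<dots> = S ** (?Q - cadj A ** ?Q ** W)"
    using S by (simp add: unitary_def matrix_diff_ldistrib matrix_mul_assoc)
  also have "?Q - cadj A ** ?Q ** W = cadj C ** U"
    using assms by (intro stein_sol)
  finally show "S ** ?Q - cadj (S ** A ** cadj S) ** (S ** ?Q) ** W = cadj (C ** cadj S) ** U"
    by (simp add: cadj_mult matrix_mul_assoc)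
qed (use assms in auto)

text \<open>\<open>P\<^sup>1\<^sup>/\<^sup>2 Q\<^sup>-\<^sup>1\<close> is the unitary change of state coordinates that makes \<open>Q\<close> equal to \<open>P\<^sup>1\<^sup>/\<^sup>2\<close>.\<close>

lemma in_chart_iff_pos_def_coordinates:
  fixes A W :: "complex^'n^'n"
  assumes onp: "output_normal_pair U W" and bal: "balanced_realization G A B C D"
  shows "in_chart U W G \<longleftrightarrow>
    (\<exists>S. unitary S \<and>
       balanced_realization G (S ** A ** cadj S) (S ** B) (C ** cadj S) D \<and>
       pos_def (stein_sol (S ** A ** cadj S) W (cadj (C ** cadj S) ** U)))"
proof
  let ?Q = "stein_sol A W (cadj C ** U)" and ?P = "chart_P U W (chart_V U W G)"
  assume chart: "in_chart U W G"
  then have P: "pos_def ?P" and inv: "invertible ?Q"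
    using in_chart_iff_stein_invertible [OF onp bal] by (auto simp: in_chart_def)
  have "hsqrt ?P ** hsqrt ?P = cadj ?Q ** ?Q"
    by (rule trans [OF hsqrt_mult_self [OF P] chart_P_eq(1) [OF onp bal]])
  define S where "S = hsqrt ?P ** matrix_inv ?Q"
  have "cadj S ** S = cadj (matrix_inv ?Q) ** (hsqrt ?P ** hsqrt ?P) ** matrix_inv ?Q"
    using P by (simp add: S_def cadj_mult cadj_hsqrt matrix_mul_assoc)
  also have "\<dots> = cadj (?Q ** matrix_inv ?Q) ** (?Q ** matrix_inv ?Q)"
    unfolding \<open>hsqrt ?P ** hsqrt ?P = cadj ?Q ** ?Q\<close> by (simp add: cadj_mult matrix_mul_assoc)
  finally have S: "unitary S"
    by (intro unitaryI) (simp add: inv matrix_inv_right)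
  have bal': "balanced_realization G (S ** A ** cadj S) (S ** B) (C ** cadj S) D"
    by (rule balanced_realization_similar [OF bal S])
  have "stein_sol (S ** A ** cadj S) W (cadj (C ** cadj S) ** U) = S ** ?Q"
    using S onp by (intro stein_sol_similar balanced_realization_stable [OF bal]
        balanced_realization_stable [OF bal']) (auto simp: output_normal_pair_def)
  also have "\<dots> = hsqrt ?P"
    by (simp add: S_def matrix_inv_left_assoc inv)
  finally have "pos_def (stein_sol (S ** A ** cadj S) W (cadj (C ** cadj S) ** U))"
    by (simp add: pos_def_hsqrt P)
  with S bal' show "\<exists>S. unitary S \<and>
       balanced_realization G (S ** A ** cadj S) (S ** B) (C ** cadj S) D \<and>
       pos_def (stein_sol (S ** A ** cadj S) W (cadj (C ** cadj S) ** U))"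
    by blast
qed (use in_chart_iff_stein_invertible [OF onp] pos_def_invertible in blast)

lemma canonical_iff_stein_eq_sqrt:
  fixes A W :: "complex^'n^'n"
  assumes onp: "output_normal_pair U W" and bal: "balanced_realization G A B C D"
    and P: "pos_def (chart_P U W (chart_V U W G))"
  shows "canonical_realization U W G A B C D \<longleftrightarrow>
    stein_sol A W (cadj C ** U) = hsqrt (chart_P U W (chart_V U W G))"
proof -
  interpret chart_point U W "chart_V U W G"
    by unfold_locales (fact onp, fact P)
  let ?V = "chart_V U W G" and ?R = "realization_matrix A B C D" and ?Q = "stein_sol A W (cadj C ** U)"
  have G: "realization G A B C D" and R: "unitary ?R"
    using bal by (auto simp: balanced_realization_def minimal_realization_def)
  have CU: "cadj CU ** CU = mat 1" "CU ** cadj CU = mat 1"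
    and CV: "cadj CV ** CV = mat 1" "CV ** cadj CV = mat 1"
    and RR: "?R ** cadj ?R = mat 1"
    using unitary_calU unitary_calV R by (auto simp: unitary_def)
  show ?thesis
  proof
    assume "canonical_realization U W G A B C D"
    then have "?R = CU ** block_mat (chart_G0 U W G) 0 0 (mat 1) ** cadj CV"
      by (simp add: canonical_realization_def)
    then have "cadj ?R ** (CU ** vcat 0 (mat 1))
        = CV ** block_mat (cadj (chart_G0 U W G)) 0 0 (mat 1) ** (cadj CU ** CU) ** vcat 0 (mat 1)"
      by (simp add: cadj_mult cadj_block_mat matrix_mul_assoc)
    also have "\<dots> = CV ** (block_mat (cadj (chart_G0 U W G)) 0 0 (mat 1) ** vcat 0 (mat 1))"
      by (simp add: CU matrix_mul_assoc)
    also have "\<dots> = CV ** vcat 0 (mat 1)"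
      by (simp add: block_mat_vcat)
    finally have "cadj ?R ** vcat U (T ** W) = vcat ?V T"
      by (simp only: calU_calV_transfer)
    then have "cadj C ** U + cadj A ** (T ** W) = T"
      by (simp add: realization_matrix_def cadj_block_mat block_mat_vcat)
    then have "T - cadj A ** T ** W = cadj C ** U"
      by (simp add: matrix_mul_assoc algebra_simps)
    then show "?Q = hsqrt P"
      unfolding T_def [symmetric]
      by (rule stein_sol_eqI [OF balanced_realization_stable [OF bal] stable_W])
  next
    assume "?Q = hsqrt P"
    then have "cadj ?R ** vcat U (T ** W) = vcat ?V T"
      using balanced_stein [OF onp bal] by (simp add: T_def)
    then have transfer: "cadj ?R ** (CU ** vcat 0 (mat 1)) = CV ** vcat 0 (mat 1)"
      by (simp only: calU_calV_transfer)
    define M where "M = cadj CU ** ?R ** CV"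
    have "unitary M"
      unfolding M_def using R by (intro unitary_mult unitary_cadj unitary_calU unitary_calV)
    have "M ** vcat 0 (mat 1) = cadj CU ** (?R ** cadj ?R) ** CU ** vcat 0 (mat 1)"
      by (simp add: M_def transfer flip: matrix_mul_assoc)
    then have "M ** vcat 0 (mat 1) = vcat 0 (mat 1)"
      by (simp add: RR CU)
    then have "block12 M = 0" "block22 M = mat 1"
      by (simp_all add: block_vcat_zero)
    then obtain F where F: "unitary F" "M = block_mat F 0 0 (mat 1)"
      using unitary_fixing_block [OF \<open>unitary M\<close>] by blast
    have "CU ** M ** cadj CV = (CU ** cadj CU) ** ?R ** (CV ** cadj CV)"
      by (simp add: M_def matrix_mul_assoc)
    then have R_eq: "?R = CU ** block_mat F 0 0 (mat 1) ** cadj CV"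
      by (simp add: CU CV F(2))
    moreover have "chart_G0 U W G = F"
      by (rule chart_G0_eq [OF G refl F(1) R_eq])
    ultimately show "canonical_realization U W G A B C D"
      using P G by (simp add: canonical_realization_def in_chart_def)
  qed
qed

theorem proposition5:
  fixes U :: "complex^'n^'p" and W :: "complex^'n^'n"
    and G :: "complex \<Rightarrow> complex^'p^'p"
    and A :: "complex^'n^'n" and B :: "complex^'p^'n" and C :: "complex^'n^'p" and D :: "complex^'p^'p"
  assumes "output_normal_pair U W"
    and "G \<in> lossless_of_degree CARD('n)"
    and "balanced_realization G A B C D"
  shows "(in_chart U W G \<longleftrightarrow>
            (\<exists>S. unitary S \<and>
               balanced_realization G (S ** A ** cadj S) (S ** B) (C ** cadj S) D \<and>
               pos_def (stein_sol (S ** A ** cadj S) W (cadj (C ** cadj S) ** U))))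
       \<and> (canonical_realization U W G A B C D \<longleftrightarrow>
            pos_def (chart_P U W (chart_V U W G)) \<and>
            stein_sol A W (cadj C ** U) = hsqrt (chart_P U W (chart_V U W G)))"
proof
  show "in_chart U W G \<longleftrightarrow>
      (\<exists>S. unitary S \<and>
         balanced_realization G (S ** A ** cadj S) (S ** B) (C ** cadj S) D \<and>
         pos_def (stein_sol (S ** A ** cadj S) W (cadj (C ** cadj S) ** U)))"
    by (rule in_chart_iff_pos_def_coordinates [OF assms(1,3)])
  have "canonical_realization U W G A B C D \<Longrightarrow> pos_def (chart_P U W (chart_V U W G))"
    by (simp add: canonical_realization_def in_chart_def)
  then show "canonical_realization U W G A B C D \<longleftrightarrow>
      pos_def (chart_P U W (chart_V U W G)) \<and>
      stein_sol A W (cadj C ** U) = hsqrt (chart_P U W (chart_V U W G))"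
    using canonical_iff_stein_eq_sqrt [OF assms(1,3)] by blast
qed

end
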